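(* Let $(G,\mathbf d,\mathbf s)$ be a generic axis-parallel direction-slider network. Then $(G,\mathbf d,\mathbf s)$ has a unique faithful realization if and only if $G$ is a color-looped-Laman graph. (Here "generic" means: for every looped graph $G$ with loops colored red or blue, with $m$ edges and $c$ loops, there is a proper algebraic subset of $\mathbb R^{2m+c}$ such that the equivalence holds for all $(\mathbf d,\mathbf s)\in\mathbb R^{2m+c}$ outside this subset.)
   Context: Looped graph: a finite graph $G=(V,E)$ with $n$ vertices, $m$ edges between distinct vertices and $c$ self-loops (at most two parallel copies of each edge and at most two loops per vertex). "Edge" means a non-loop edge; $i_j$ denotes the $j$-th loop on vertex $i$. Looped-Laman graph: a looped graph with $m+c=2n$ such that (i) every subgraph with $n'\ge 2$ vertices has at most $2n'-3$ edges (loops not counted), and (ii) every subgraph with $n'$ vertices, $m'$ edges and $c'$ loops satisfies $m'+c'\le 2n'$. Color-looped-Laman graph: a looped graph whose loops are each colored red or blue, which is looped-Laman and whose edges can be colored red and blue so that, for each color, the edges of that color form a forest on the vertex set $V$ and every tree of this forest (isolated vertices counting as trees) contains exactly one loop of that color. Axis-parallel direction-slider network $(G,\mathbf d,\mathbf s)$: a looped graph $G$ with each loop colored red (vertical slider) or blue (horizontal slider), a direction $\mathbf d_{ij}\in\mathbb R^2$ for each edge $ij$, and a number $s_{i_j}\in\mathbb R$ for each loop $i_j$. A realization is given by $\mathbf p\in(\mathbb R^2)^n$, $\mathbf p_i=(x_i,y_i)$, with $\langle \mathbf p_i-\mathbf p_j,\mathbf d_{ij}^{\perp}\rangle=0$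 for all edges $ij$, $x_i=s_{i_j}$ for every red loop $i_j$, and $y_i=s_{i_j}$ for every blue loop $i_j$; $(a,b)^\perp$ is $(a,b)$ rotated by $90^\circ$. A realization is faithful if $\mathbf p_i\ne\mathbf p_j$ for every edge $ij$. *)

theory Defs
  imports "HOL-Analysis.Analysis" "HOL-Library.FuncSet"
begin

datatype color = Red | Blue

text \<open>Edges and loops are abstract identifiers, so parallel edges and several loops on
  one vertex are distinct objects.\<close>

record ('v, 'e, 'l) lgraph =
  verts :: "'v set"
  edges :: "'e set"
  ends :: "'e \<Rightarrow> 'v set"
  loops :: "'l set"
  base :: "'l \<Rightarrow> 'v"
  loop_color :: "'l \<Rightarrow> color"

definition looped_graph :: "('v, 'e, 'l) lgraph \<Rightarrow> bool" where
  "looped_graph G \<longleftrightarrow>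
     finite (verts G) \<and> finite (edges G) \<and> finite (loops G) \<and>
     (\<forall>e\<in>edges G. \<exists>i\<in>verts G. \<exists>j\<in>verts G. i \<noteq> j \<and> ends G e = {i, j}) \<and>
     (\<forall>l\<in>loops G. base G l \<in> verts G) \<and>
     (\<forall>i\<in>verts G. \<forall>j\<in>verts G. card {e \<in> edges G. ends G e = {i, j}} \<le> 2) \<and>
     (\<forall>i\<in>verts G. card {l \<in> loops G. base G l = i} \<le> 2)"


subsection \<open>Looped-Laman graphs\<close>

definition subgraph :: "'v set \<Rightarrow> 'e set \<Rightarrow> 'l set \<Rightarrow> ('v, 'e, 'l) lgraph \<Rightarrow> bool" where
  "subgraph V E L G \<longleftrightarrow>
     V \<subseteq> verts G \<and> E \<subseteq> edges G \<and> L \<subseteq> loops G \<and>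
     (\<forall>e\<in>E. ends G e \<subseteq> V) \<and> (\<forall>l\<in>L. base G l \<in> V)"

text \<open>The integer coercions avoid truncated subtraction.\<close>

definition looped_Laman :: "('v, 'e, 'l) lgraph \<Rightarrow> bool" where
  "looped_Laman G \<longleftrightarrow>
     card (edges G) + card (loops G) = 2 * card (verts G) \<and>
     (\<forall>V E L. subgraph V E L G \<longrightarrow>
        (card V \<ge> 2 \<longrightarrow> int (card E) \<le> 2 * int (card V) - 3) \<and>
        card E + card L \<le> 2 * card V)"


subsection \<open>Color-looped-Laman graphs\<close>

text \<open>Two parallel edges form a cycle of length 2; this is why the edges are listed
  and required to be distinct.\<close>

definition cycle_in :: "('v, 'e, 'l) lgraph \<Rightarrow> 'e set \<Rightarrow> 'v list \<Rightarrow> 'e list \<Rightarrow> bool" where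
  "cycle_in G F vs es \<longleftrightarrow>
     length vs = length es \<and> length es \<ge> 2 \<and> distinct vs \<and> distinct es \<and> set es \<subseteq> F \<and>
     (\<forall>k<length es. ends G (es ! k) = {vs ! k, vs ! (Suc k mod length vs)})"

definition forest :: "('v, 'e, 'l) lgraph \<Rightarrow> 'e set \<Rightarrow> bool" where
  "forest G F \<longleftrightarrow> F \<subseteq> edges G \<and> (\<nexists>vs es. cycle_in G F vs es)"

definition adjacency :: "('v, 'e, 'l) lgraph \<Rightarrow> 'e set \<Rightarrow> ('v \<times> 'v) set" where
  "adjacency G F = {(i, j). \<exists>e\<in>F. ends G e = {i, j}}"

text \<open>Vertex sets of the connected components of the spanning subgraph with edge set \<open>F\<close>,
  isolated vertices included.\<close>

definition components_of_edges :: "('v, 'e, 'l) lgraph \<Rightarrow> 'e set \<Rightarrow> 'v set set" where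
  "components_of_edges G F =
     verts G // {(i, j). i \<in> verts G \<and> j \<in> verts G \<and> (i, j) \<in> (adjacency G F)\<^sup>*}"

definition color_looped_Laman :: "('v, 'e, 'l) lgraph \<Rightarrow> bool" where
  "color_looped_Laman G \<longleftrightarrow>
     looped_Laman G \<and>
     (\<exists>edge_color :: 'e \<Rightarrow> color. \<forall>col.
        forest G {e \<in> edges G. edge_color e = col} \<and>
        (\<forall>T\<in>components_of_edges G {e \<in> edges G. edge_color e = col}.
           \<exists>!l. l \<in> loops G \<and> loop_color G l = col \<and> base G l \<in> T))"


subsection \<open>Axis-parallel direction-slider networks\<close>

definition perp :: "real^2 \<Rightarrow> real^2" where
  "perp v = vector [- (v $ 2), v $ 1]"

text \<open>Placements are extensional functions on the vertex set, so that uniqueness of a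
  placement is uniqueness of the points of the vertices. The edge equation does not depend
  on the order in which the two endpoints are named.\<close>

definition realization ::
  "('v, 'e, 'l) lgraph \<Rightarrow> ('e \<Rightarrow> real^2) \<Rightarrow> ('l \<Rightarrow> real) \<Rightarrow> ('v \<Rightarrow> real^2) \<Rightarrow> bool" where
  "realization G d s p \<longleftrightarrow>
     p \<in> verts G \<rightarrow>\<^sub>E UNIV \<and>
     (\<forall>e\<in>edges G. \<forall>i j. ends G e = {i, j} \<longrightarrow> (p i - p j) \<bullet> perp (d e) = 0) \<and>
     (\<forall>l\<in>loops G. loop_color G l = Red \<longrightarrow> p (base G l) $ 1 = s l) \<and>
     (\<forall>l\<in>loops G. loop_color G l = Blue \<longrightarrow> p (base G l) $ 2 = s l)"

definition faithful :: "('v, 'e, 'l) lgraph \<Rightarrow> ('v \<Rightarrow> real^2) \<Rightarrow> bool" where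
  "faithful G p \<longleftrightarrow> (\<forall>e\<in>edges G. \<forall>i j. ends G e = {i, j} \<longrightarrow> p i \<noteq> p j)"


subsection \<open>Algebraic subsets of the parameter space\<close>

text \<open>The space of all pairs \<open>(d, s)\<close>: a copy of \<open>\<real>\<close> to the power \<open>2m + c\<close>,
  with the two coordinates of each \<open>d e\<close> and the numbers \<open>s l\<close> as coordinates.\<close>

definition param_space :: "('v, 'e, 'l) lgraph \<Rightarrow> (('e \<Rightarrow> real^2) \<times> ('l \<Rightarrow> real)) set" where
  "param_space G = (edges G \<rightarrow>\<^sub>E UNIV) \<times> (loops G \<rightarrow>\<^sub>E UNIV)"

text \<open>Polynomial functions in these coordinates, in the style of
  \<open>real_polynomial_function\<close> (which needs a normed vector space type and so does not
  apply to finite index sets that may be empty).\<close>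

inductive param_polynomial ::
  "('v, 'e, 'l) lgraph \<Rightarrow> (('e \<Rightarrow> real^2) \<times> ('l \<Rightarrow> real) \<Rightarrow> real) \<Rightarrow> bool"
  for G :: "('v, 'e, 'l) lgraph" where
  dir_coord: "e \<in> edges G \<Longrightarrow> param_polynomial G (\<lambda>(d, s). d e $ k)"
| slider_coord: "l \<in> loops G \<Longrightarrow> param_polynomial G (\<lambda>(d, s). s l)"
| const: "param_polynomial G (\<lambda>_. a)"
| add: "param_polynomial G f \<Longrightarrow> param_polynomial G g \<Longrightarrow> param_polynomial G (\<lambda>x. f x + g x)"
| mult: "param_polynomial G f \<Longrightarrow> param_polynomial G g \<Longrightarrow> param_polynomial G (\<lambda>x. f x * g x)"

definition algebraic_subset ::
  "('v, 'e, 'l) lgraph \<Rightarrow> (('e \<Rightarrow> real^2) \<times> ('l \<Rightarrow> real)) set \<Rightarrow> bool" where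
  "algebraic_subset G S \<longleftrightarrow>
     (\<exists>P. finite P \<and> (\<forall>f\<in>P. param_polynomial G f) \<and>
        S = {x \<in> param_space G. \<forall>f\<in>P. f x = 0})"

definition proper_algebraic_subset ::
  "('v, 'e, 'l) lgraph \<Rightarrow> (('e \<Rightarrow> real^2) \<times> ('l \<Rightarrow> real)) set \<Rightarrow> bool" where
  "proper_algebraic_subset G S \<longleftrightarrow> algebraic_subset G S \<and> S \<noteq> param_space G"

end

theory Submission
  imports Defs "HOL-Computational_Algebra.Polynomial"
begin

text \<open>A realization is a solution of a linear system in \<open>2n\<close> unknowns with \<open>m + c\<close> equations.

  Suppose a generic network has a unique faithful realization. A faithful realization gives
  \<open>d\<^sub>e = t\<^sub>e (p\<^sub>i - p\<^sub>j)\<close>, so \<open>(d, s)\<close> lies in the image of a polynomial map; if a subgraph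
  has too many edges or loops, the domain of this map has a smaller dimension than its target and
  its image satisfies a polynomial equation. Uniqueness makes the system nonsingular, hence square.
  Each row of an edge is a combination of the rows for the two axis directions, so each direction
  can be replaced by one of them with the system still nonsingular. This colors the edges, and
  nonsingularity of the two resulting graph systems is the condition on forests and loops.

  Conversely, a coloring gives axis directions for which the system is nonsingular, so it is
  nonsingular generically. Let \<open>C\<close> be the set of edges whose ends coincide in all generic
  solutions. Perturbing the direction of an edge outside \<open>C\<close> shows that its equation is not needed
  for the collapse of \<open>C\<close>. Hence the equations of \<open>C\<close> alone collapse \<open>C\<close>, and a component of \<open>C\<close>
  on \<open>n'\<close> vertices has at least \<open>2n' - 2\<close> edges, which is excluded by the looped-Laman
  condition.\<close>

subsection \<open>Linear systems\<close>

text \<open>Elimination of one equation at a time: an equation with a nonzero coefficient removes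
  its unknown \<open>j0\<close>, and one without drops out. The solution is 0 outside
  \<open>J\<close> so that it can later serve as a vector on all unknowns.\<close>

lemma underdetermined_system:
  fixes A :: "'i \<Rightarrow> 'j \<Rightarrow> real"
  assumes "finite I" "finite J" "card I < card J"
  shows "\<exists>u. (\<exists>j\<in>J. u j \<noteq> 0) \<and> (\<forall>j. j \<notin> J \<longrightarrow> u j = 0) \<and>
           (\<forall>i\<in>I. (\<Sum>j\<in>J. A i j * u j) = 0)"
  using assms
proof (induction I arbitrary: A J rule: finite_induct)
  case empty
  then obtain j where "j \<in> J" by (metis card.empty equals0I less_irrefl)
  then show ?case by (intro exI[of _ "\<lambda>k. if k = j then 1 else 0"]) auto
next
  case (insert i0 I)
  show ?case
  proof (cases "\<forall>j\<in>J. A i0 j = 0")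
    case True
    have "card I < card J" using insert by simp
    from insert.IH[OF \<open>finite J\<close> this, of A] obtain u where
      "\<exists>j\<in>J. u j \<noteq> 0" "\<forall>j. j \<notin> J \<longrightarrow> u j = 0" "\<forall>i\<in>I. (\<Sum>j\<in>J. A i j * u j) = 0" by blast
    with True show ?thesis by (intro exI[of _ u]) auto
  next
    case False
    then obtain j0 where j0: "j0 \<in> J" "A i0 j0 \<noteq> 0" by blast
    define A' where "A' i j = A i j - A i j0 / A i0 j0 * A i0 j" for i j
    have "card I < card (J - {j0})" using insert j0 by simp
    with insert.IH[of "J - {j0}" A'] \<open>finite J\<close> obtain u where
      u: "\<exists>j\<in>J - {j0}. u j \<noteq> 0" "\<forall>j. j \<notin> J - {j0} \<longrightarrow> u j = 0"
        "\<forall>i\<in>I. (\<Sum>j\<in>J - {j0}. A' i j * u j) = 0" by blast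
    define v where "v = u(j0 := - (\<Sum>j\<in>J - {j0}. A i0 j * u j) / A i0 j0)"
    have split: "(\<Sum>j\<in>J. A i j * v j) = A i j0 * v j0 + (\<Sum>j\<in>J - {j0}. A i j * u j)" for i
      using j0 \<open>finite J\<close> by (subst sum.remove[of _ j0]) (auto simp: v_def intro!: sum.cong)
    have "(\<Sum>j\<in>J. A i j * v j) = 0" if "i \<in> I" for i
    proof -
      have "0 = (\<Sum>j\<in>J - {j0}. A' i j * u j)" using u that by simp
      also have "\<dots> = (\<Sum>j\<in>J - {j0}. A i j * u j)
          - A i j0 / A i0 j0 * (\<Sum>j\<in>J - {j0}. A i0 j * u j)"
        by (simp add: A'_def algebra_simps sum_subtractf sum_distrib_left)
      finally show ?thesis unfolding split by (simp add: v_def)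
    qed
    moreover have "(\<Sum>j\<in>J. A i0 j * v j) = 0"
      unfolding split using j0 by (simp add: v_def)
    moreover have "\<exists>j\<in>J. v j \<noteq> 0" using u(1) by (auto simp: v_def)
    moreover have "\<forall>j. j \<notin> J \<longrightarrow> v j = 0" using u(2) j0 by (auto simp: v_def)
    ultimately show ?thesis by (intro exI[of _ v]) auto
  qed
qed

text \<open>Homogenization: with the column \<open>- b\<close> added there are more unknowns than
  equations. The trivial kernel makes the extra coordinate of a nonzero solution nonzero, and
  dividing by it gives the solution.\<close>

lemma square_system_solvable:
  fixes A :: "'i \<Rightarrow> 'j \<Rightarrow> real"
  assumes "finite I" "finite J" "card I = card J"
    and ker: "\<And>u. \<forall>i\<in>I. (\<Sum>j\<in>J. A i j * u j) = 0 \<Longrightarrow> \<forall>j\<in>J. u j = 0"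
  shows "\<exists>u. \<forall>i\<in>I. (\<Sum>j\<in>J. A i j * u j) = b i"
proof -
  define A' where "A' i k = (case k of None \<Rightarrow> - b i | Some j \<Rightarrow> A i j)" for i k
  have sum: "(\<Sum>k\<in>insert None (Some ` J). A' i k * u k)
      = - b i * u None + (\<Sum>j\<in>J. A i j * u (Some j))" for i u
    using \<open>finite J\<close> by (subst sum.insert) (auto simp: A'_def sum.reindex)
  have "card I < card (insert None (Some ` J))"
    using assms by (simp add: card_image)
  from underdetermined_system[OF \<open>finite I\<close> _ this, of A'] \<open>finite J\<close>
  obtain u where nz: "\<exists>k\<in>insert None (Some ` J). u k \<noteq> 0"
    and u: "\<forall>i\<in>I. - b i * u None + (\<Sum>j\<in>J. A i j * u (Some j)) = 0"
    unfolding sum by auto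
  have "u None \<noteq> 0"
  proof
    assume "u None = 0"
    with u ker[of "\<lambda>j. u (Some j)"] nz show False by auto
  qed
  then have "\<forall>i\<in>I. (\<Sum>j\<in>J. A i j * (u (Some j) / u None)) = b i"
    using u by (simp add: sum_divide_distrib[symmetric] field_simps)
  then show ?thesis by (rule exI[of _ "\<lambda>j. u (Some j) / u None"])
qed

text \<open>Gaussian elimination with coefficients in a ring \<open>Q\<close> of functions and right-hand
  sides in a larger ring \<open>P\<close>. In place of Cramer's rule, the witness \<open>g\<close> is the product of
  the pivots, chosen to be nonzero at \<open>x0\<close>.\<close>

lemma generic_elimination:
  fixes A :: "'i \<Rightarrow> 'j \<Rightarrow> 'x \<Rightarrow> real" and b :: "'i \<Rightarrow> 'x \<Rightarrow> real"
  assumes Qmult: "\<And>f h. Q f \<Longrightarrow> Q h \<Longrightarrow> Q (\<lambda>x. f x * h x)"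
    and Qdiff: "\<And>f h. Q f \<Longrightarrow> Q h \<Longrightarrow> Q (\<lambda>x. f x - h x)"
    and Qone: "Q (\<lambda>x. 1)"
    and QP: "\<And>f. Q f \<Longrightarrow> P f"
    and Pmult: "\<And>f h. P f \<Longrightarrow> P h \<Longrightarrow> P (\<lambda>x. f x * h x)"
    and Pdiff: "\<And>f h. P f \<Longrightarrow> P h \<Longrightarrow> P (\<lambda>x. f x - h x)"
    and "finite I" "finite J" "card I = card J"
    and "\<And>i j. i \<in> I \<Longrightarrow> j \<in> J \<Longrightarrow> Q (A i j)" "\<And>i. i \<in> I \<Longrightarrow> P (b i)"
    and "\<And>u. \<forall>i\<in>I. (\<Sum>j\<in>J. A i j x0 * u j) = 0 \<Longrightarrow> \<forall>j\<in>J. u j = 0"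
  shows "\<exists>g q. Q g \<and> g x0 \<noteq> 0 \<and> (\<forall>j\<in>J. P (q j)) \<and>
    (\<forall>x u. (\<forall>i\<in>I. (\<Sum>j\<in>J. A i j x * u j) = 0) \<longrightarrow> (\<forall>j\<in>J. g x * u j = 0)) \<and>
    (\<forall>x u. (\<forall>i\<in>I. (\<Sum>j\<in>J. A i j x * u j) = b i x) \<longrightarrow> (\<forall>j\<in>J. g x * u j = q j x))"
  using assms(7-)
proof (induction "card J" arbitrary: I J A b)
  case 0
  then show ?case using Qone by (intro exI[of _ "\<lambda>_. 1"]) auto
next
  case (Suc n)
  note fin = \<open>finite I\<close> \<open>finite J\<close>
  obtain j0 where j0: "j0 \<in> J" using Suc.hyps(2) by fastforce
  \<comment> \<open>A zero column at \<open>x0\<close> would put the unit vector of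
    \<open>j0\<close> into the kernel at \<open>x0\<close>.\<close>
  obtain i0 where i0: "i0 \<in> I" "A i0 j0 x0 \<noteq> 0"
  proof (rule ccontr)
    assume "\<not> thesis"
    then have "\<forall>i\<in>I. A i j0 x0 = 0" using that by blast
    then have "\<forall>i\<in>I. (\<Sum>j\<in>J. A i j x0 * (if j = j0 then 1 else 0)) = 0"
      using fin by (simp add: if_distrib[of "(*) _"] cong: if_cong)
    from Suc.prems(6)[OF this] j0 show False by auto
  qed
  let ?I = "I - {i0}" and ?J = "J - {j0}"
  \<comment> \<open>Cross-multiplication clears the column \<open>j0\<close> without dividing, so
    the new entries stay in \<open>Q\<close> and the new right-hand sides in
    \<open>P\<close>.\<close>
  define A' where "A' i j = (\<lambda>x. A i0 j0 x * A i j x - A i j0 x * A i0 j x)" for i j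
  define b' where "b' i = (\<lambda>x. A i0 j0 x * b i x - A i j0 x * b i0 x)" for i
  have PA: "P (A i j)" if "i \<in> I" "j \<in> J" for i j
    using that by (intro QP Suc.prems(4))
  have split: "(\<Sum>j\<in>J. A i j x * u j) = A i j0 x * u j0 + (\<Sum>j\<in>?J. A i j x * u j)" for i x u
    using j0 fin by (rule_tac sum.remove) auto
  have A': "(\<Sum>j\<in>?J. A' i j x * u j) =
      A i0 j0 x * (\<Sum>j\<in>J. A i j x * u j) - A i j0 x * (\<Sum>j\<in>J. A i0 j x * u j)" for i x u
    unfolding split by (simp add: A'_def algebra_simps sum_subtractf sum_distrib_left)
  have ker': "\<forall>j\<in>?J. u j = 0" if u: "\<forall>i\<in>?I. (\<Sum>j\<in>?J. A' i j x0 * u j) = 0" for u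
  proof -
    define v where "v = u(j0 := - (\<Sum>j\<in>?J. A i0 j x0 * u j) / A i0 j0 x0)"
    have same: "(\<Sum>j\<in>?J. c j * v j) = (\<Sum>j\<in>?J. c j * u j)" for c
      by (rule sum.cong) (auto simp: v_def)
    have v0: "(\<Sum>j\<in>J. A i0 j x0 * v j) = 0"
      unfolding split same using i0 by (simp add: v_def)
    moreover have "(\<Sum>j\<in>J. A i j x0 * v j) = 0" if "i \<in> ?I" for i
      using A'[of i x0 v] u that i0 unfolding v0 same by simp
    ultimately have "\<forall>i\<in>I. (\<Sum>j\<in>J. A i j x0 * v j) = 0" by blast
    from Suc.prems(6)[OF this] show ?thesis by (auto simp: v_def split: if_splits)
  qed
  have "n = card ?J" "card ?I = card ?J" "finite ?I" "finite ?J"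
    using Suc.hyps(2) Suc.prems(3) fin i0 j0 by auto
  moreover have "Q (A' i j)" if "i \<in> ?I" "j \<in> ?J" for i j
    unfolding A'_def using that i0 j0 Suc.prems(4) by (intro Qdiff Qmult) auto
  moreover have "P (b' i)" if "i \<in> ?I" for i
    unfolding b'_def using that i0 j0 by (intro Pdiff Pmult PA Suc.prems(5)) auto
  ultimately obtain g q where gq: "Q g" "g x0 \<noteq> 0" "\<forall>j\<in>?J. P (q j)"
    "\<And>x u. \<forall>i\<in>?I. (\<Sum>j\<in>?J. A' i j x * u j) = 0 \<Longrightarrow> \<forall>j\<in>?J. g x * u j = 0"
    "\<And>x u. \<forall>i\<in>?I. (\<Sum>j\<in>?J. A' i j x * u j) = b' i x \<Longrightarrow> \<forall>j\<in>?J. g x * u j = q j x"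
    using Suc.hyps(1)[of ?J ?I A' b'] ker' by blast
  define h where "h = (\<lambda>x. A i0 j0 x * g x)"
  \<comment> \<open>The pivot equation times \<open>g\<close>, solved for its term in
    \<open>j0\<close>, gives \<open>r j0\<close>; the other numerators pick up the new pivot factor
    of \<open>h\<close>.\<close>
  define r where "r j = (if j = j0 then (\<lambda>x. g x * b i0 x - (\<Sum>j\<in>?J. A i0 j x * q j x))
      else (\<lambda>x. A i0 j0 x * q j x))" for j
  have "Q h" unfolding h_def using i0 j0 Suc.prems(4) gq by (intro Qmult) auto
  moreover have "h x0 \<noteq> 0" using i0 gq by (simp add: h_def)
  moreover have "P (r j)" if "j \<in> J" for j
  proof -
    have "P (\<lambda>x. 1)" by (rule QP[OF Qone])
    then have Pzero: "P (\<lambda>x. 0)" using Pdiff[of "\<lambda>x. 1" "\<lambda>x. 1"] by simp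
    have Padd: "P (\<lambda>x. f x + k x)" if "P f" "P k" for f k
      using Pdiff[OF that(1) Pdiff[OF Pzero that(2)]] by simp
    have Psum: "P (\<lambda>x. \<Sum>j\<in>S. f j x)" if "finite S" "\<forall>j\<in>S. P (f j)" for S :: "'j set" and f
      using that by (induction S rule: finite_induct) (auto intro: Pzero Padd)
    show ?thesis unfolding r_def using that i0 j0 gq fin
      by (auto intro!: Pdiff Pmult Psum PA Suc.prems(5) intro: QP)
  qed
  moreover have "h x * u j = 0"
    if u: "\<forall>i\<in>I. (\<Sum>j\<in>J. A i j x * u j) = 0" and "j \<in> J" for x u j
  proof -
    have g0: "\<forall>j\<in>?J. g x * u j = 0" using u i0 by (intro gq(4)) (simp add: A')
    have "A i0 j0 x * u j0 + (\<Sum>j\<in>?J. A i0 j x * u j) = 0" using u i0 unfolding split by simp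
    then have "A i0 j0 x * u j0 = - (\<Sum>j\<in>?J. A i0 j x * u j)" by linarith
    then have "h x * u j0 = g x * - (\<Sum>j\<in>?J. A i0 j x * u j)"
      unfolding h_def by (metis mult.assoc mult.commute)
    also have "\<dots> = - (\<Sum>j\<in>?J. A i0 j x * (g x * u j))"
      by (simp add: sum_distrib_left mult.left_commute)
    also have "\<dots> = 0" using g0 by (auto intro!: sum.neutral)
    finally show ?thesis using g0 that(2) by (cases "j = j0") (auto simp: h_def)
  qed
  moreover have "h x * u j = r j x"
    if u: "\<forall>i\<in>I. (\<Sum>j\<in>J. A i j x * u j) = b i x" and "j \<in> J" for x u j
  proof -
    have g0: "\<forall>j\<in>?J. g x * u j = q j x" using u i0 by (intro gq(5)) (simp add: A' b'_def)
    have "A i0 j0 x * u j0 = b i0 x - (\<Sum>j\<in>?J. A i0 j x * u j)"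
      using u i0 unfolding split by (simp add: algebra_simps)
    then have "h x * u j0 = g x * (b i0 x - (\<Sum>j\<in>?J. A i0 j x * u j))"
      unfolding h_def by (metis mult.assoc mult.commute)
    also have "\<dots> = g x * b i0 x - (\<Sum>j\<in>?J. A i0 j x * (g x * u j))"
      by (simp add: sum_distrib_left mult.left_commute right_diff_distrib)
    also have "\<dots> = r j0 x" using g0 by (simp add: r_def)
    finally show ?thesis using g0 that(2) by (cases "j = j0") (auto simp: h_def r_def)
  qed
  ultimately show ?case by blast
qed

subsection \<open>Algebraic dependence of polynomial functions\<close>

lemma nonzero_poly_nonroot:
  fixes p :: "real poly"
  assumes "p \<noteq> 0"
  shows "\<exists>t. t \<noteq> a \<and> poly p t \<noteq> 0"
proof -
  have "finite ({a} \<union> {t. poly p t = 0})" using assms poly_roots_finite by simp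
  then obtain t where "t \<notin> {a} \<union> {t. poly p t = 0}"
    using ex_new_if_finite[OF infinite_UNIV_char_0] by blast
  then show ?thesis by blast
qed

text \<open>\<open>D\<close> bounds the exponent of each variable separately, not the total degree,
  so at most \<open>(D + 1) ^ card J\<close> monomials occur.\<close>

inductive bounded_degree :: "'j set \<Rightarrow> nat \<Rightarrow> (('j \<Rightarrow> real) \<Rightarrow> real) \<Rightarrow> bool"
  for J :: "'j set" and D :: nat where
  monomial: "\<forall>j\<in>J. \<beta> j \<le> D \<Longrightarrow> bounded_degree J D (\<lambda>z. c * (\<Prod>j\<in>J. z j ^ \<beta> j))"
| add: "bounded_degree J D f \<Longrightarrow> bounded_degree J D g \<Longrightarrow> bounded_degree J D (\<lambda>z. f z + g z)"

lemma bounded_degree_const: "bounded_degree J D (\<lambda>z. c)"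
  using bounded_degree.monomial[of J "\<lambda>_. 0" D c] by simp

lemma bounded_degree_coordinate:
  assumes "finite J" "j \<in> J"
  shows "bounded_degree J 1 (\<lambda>z. z j)"
proof -
  have "(\<lambda>z. 1 * (\<Prod>k\<in>J. z k ^ (if k = j then 1 else 0))) = (\<lambda>z. z j :: real)"
    using assms by (simp add: if_distrib[of "power _"] prod.delta cong: if_cong)
  then show ?thesis
    using bounded_degree.monomial[of J "\<lambda>k. if k = j then 1 else 0" 1 1] by simp
qed

lemma bounded_degree_mono:
  assumes "bounded_degree J D f" "D \<le> D'"
  shows "bounded_degree J D' f"
  using assms(1) by induction (use assms(2) in \<open>auto intro!: bounded_degree.intros intro: order_trans\<close>)

lemma bounded_degree_mult:
  assumes "bounded_degree J D f" "bounded_degree J D' g"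
  shows "bounded_degree J (D + D') (\<lambda>z. f z * g z)"
  using assms(1)
proof induction
  case (monomial \<beta> c)
  show ?case using assms(2)
  proof induction
    case (monomial \<beta>' c')
    have "bounded_degree J (D + D') (\<lambda>z. c * c' * (\<Prod>j\<in>J. z j ^ (\<beta> j + \<beta>' j)))"
      using monomial \<open>\<forall>j\<in>J. \<beta> j \<le> D\<close> by (intro bounded_degree.monomial) (auto intro: add_mono)
    then show ?case by (simp add: power_add prod.distrib mult_ac)
  next
    case (add g h)
    then show ?case by (simp add: distrib_left bounded_degree.add)
  qed
next
  case (add f h)
  then show ?case by (simp add: distrib_right bounded_degree.add)
qed

lemma bounded_degree_power:
  assumes "bounded_degree J D f"
  shows "bounded_degree J (n * D) (\<lambda>z. f z ^ n)"
proof (induction n)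
  case 0
  show ?case by (simp add: bounded_degree_const)
next
  case (Suc n)
  then show ?case using bounded_degree_mult[OF assms Suc] by simp
qed

lemma bounded_degree_prod:
  assumes "finite K" "\<And>k. k \<in> K \<Longrightarrow> bounded_degree J D (f k)"
  shows "bounded_degree J (card K * D) (\<lambda>z. \<Prod>k\<in>K. f k z)"
  using assms
proof (induction K rule: finite_induct)
  case empty
  show ?case by (simp add: bounded_degree_const)
next
  case (insert k K)
  then show ?case using bounded_degree_mult[of J D "f k" "card K * D" "\<lambda>z. \<Prod>k\<in>K. f k z"] by simp
qed

lemma bounded_degree_expansion:
  assumes "bounded_degree J D f" "finite J"
  shows "\<exists>A. \<forall>z. f z = (\<Sum>\<beta>\<in>J \<rightarrow>\<^sub>E {..D}. A \<beta> * (\<Prod>j\<in>J. z j ^ \<beta> j))"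
  using assms(1)
proof induction
  case (monomial \<beta> c)
  have fin: "finite (J \<rightarrow>\<^sub>E {..D})" using assms(2) by (intro finite_PiE) auto
  have mem: "restrict \<beta> J \<in> J \<rightarrow>\<^sub>E {..D}" using monomial by auto
  have "(\<Sum>\<gamma>\<in>J \<rightarrow>\<^sub>E {..D}. (if \<gamma> = restrict \<beta> J then c else 0) * (\<Prod>j\<in>J. z j ^ \<gamma> j))
      = (\<Sum>\<gamma>\<in>J \<rightarrow>\<^sub>E {..D}. if \<gamma> = restrict \<beta> J then c * (\<Prod>j\<in>J. z j ^ \<beta> j) else 0)"
    for z :: "'a \<Rightarrow> real"
    by (intro sum.cong) (auto intro!: prod.cong)
  also have "\<dots> z = c * (\<Prod>j\<in>J. z j ^ \<beta> j)" for z using fin mem by (subst sum.delta) auto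
  finally show ?case by (intro exI[of _ "\<lambda>\<gamma>. if \<gamma> = restrict \<beta> J then c else 0"]) simp
next
  case (add f g)
  then obtain A B where "\<forall>z. f z = (\<Sum>\<beta>\<in>J \<rightarrow>\<^sub>E {..D}. A \<beta> * (\<Prod>j\<in>J. z j ^ \<beta> j))"
    "\<forall>z. g z = (\<Sum>\<beta>\<in>J \<rightarrow>\<^sub>E {..D}. B \<beta> * (\<Prod>j\<in>J. z j ^ \<beta> j))" by blast
  then show ?case
    by (intro exI[of _ "\<lambda>\<beta>. A \<beta> + B \<beta>"]) (simp add: distrib_right sum.distrib)
qed

text \<open>Induction on the variables: some values of the other variables make the coefficient of
  \<open>y k ^ \<alpha> k\<close> nonzero, and a nonzero polynomial in \<open>y k\<close> alone has
  a nonroot.\<close>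

lemma nonzero_coefficients_nonroot:
  fixes c :: "('k \<Rightarrow> nat) \<Rightarrow> real"
  assumes "finite K" "\<alpha> \<in> K \<rightarrow>\<^sub>E {..<N}" "c \<alpha> \<noteq> 0"
  shows "\<exists>y. (\<Sum>\<alpha>\<in>K \<rightarrow>\<^sub>E {..<N}. c \<alpha> * (\<Prod>k\<in>K. y k ^ \<alpha> k)) \<noteq> 0"
  using assms
proof (induction K arbitrary: \<alpha> c rule: finite_induct)
  case empty
  then show ?case by auto
next
  case (insert k K)
  have sum: "(\<Sum>\<alpha>\<in>insert k K \<rightarrow>\<^sub>E {..<N}. c \<alpha> * (\<Prod>k\<in>insert k K. y k ^ \<alpha> k))
     = (\<Sum>a<N. y k ^ a * (\<Sum>\<alpha>\<in>K \<rightarrow>\<^sub>E {..<N}. c (\<alpha>(k := a)) * (\<Prod>k\<in>K. y k ^ \<alpha> k)))" for y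
  proof -
    have inj: "inj_on (\<lambda>(a, \<alpha>). \<alpha>(k := a)) ({..<N} \<times> (K \<rightarrow>\<^sub>E {..<N}))"
      using inj_combinator[OF insert.hyps(2), of "\<lambda>_. {..<N}"] by simp
    have "(\<Prod>i\<in>K. y i ^ (\<alpha>(k := a)) i) = (\<Prod>i\<in>K. y i ^ \<alpha> i)" for a \<alpha>
      using insert.hyps by (intro prod.cong) auto
    then show ?thesis
      unfolding PiE_insert_eq sum.reindex[OF inj]
      using insert.hyps
      by (simp add: sum.cartesian_product[symmetric] case_prod_unfold comp_def sum_distrib_left mult_ac)
         (simp add: sum.cartesian_product case_prod_unfold mult_ac)
  qed
  have "restrict \<alpha> K \<in> K \<rightarrow>\<^sub>E {..<N}" using insert.prems by auto
  moreover have "(restrict \<alpha> K)(k := \<alpha> k) = \<alpha>"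
    using insert.prems(1) by (auto simp: fun_eq_iff PiE_def extensional_def)
  ultimately obtain y where
    y: "(\<Sum>\<beta>\<in>K \<rightarrow>\<^sub>E {..<N}. c (\<beta>(k := \<alpha> k)) * (\<Prod>k\<in>K. y k ^ \<beta> k)) \<noteq> 0"
    using insert.IH[of "restrict \<alpha> K" "\<lambda>\<beta>. c (\<beta>(k := \<alpha> k))"] insert.prems(2) by metis
  define p where "p = (\<Sum>a<N. monom (\<Sum>\<beta>\<in>K \<rightarrow>\<^sub>E {..<N}. c (\<beta>(k := a)) * (\<Prod>k\<in>K. y k ^ \<beta> k)) a)"
  have "\<alpha> k < N" using insert.prems by (auto simp: PiE_iff)
  then have "coeff p (\<alpha> k) \<noteq> 0" using y by (simp add: p_def coeff_sum)
  then have "p \<noteq> 0" by auto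
  then obtain t where t: "poly p t \<noteq> 0" using nonzero_poly_nonroot by blast
  have "(\<Prod>i\<in>K. (y(k := t)) i ^ \<beta> i) = (\<Prod>i\<in>K. y i ^ \<beta> i)" for \<beta>
    using insert.hyps by (intro prod.cong) auto
  then have "(\<Sum>\<alpha>\<in>insert k K \<rightarrow>\<^sub>E {..<N}. c \<alpha> * (\<Prod>i\<in>insert k K. (y(k := t)) i ^ \<alpha> i)) = poly p t"
    unfolding sum by (simp add: p_def poly_sum poly_monom mult_ac)
  with t show ?case by metis
qed

text \<open>There are \<open>N\<^sup>|\<^sup>K\<^sup>|\<close> monomials of degree below \<open>N\<close> in each \<open>\<Phi> k\<close>, but as functions
  of \<open>z\<close> they lie in a space of dimension \<open>O(N\<^sup>|\<^sup>J\<^sup>|)\<close>.\<close>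

lemma algebraic_dependence:
  fixes \<Phi> :: "'k \<Rightarrow> ('j \<Rightarrow> real) \<Rightarrow> real"
  assumes "finite J" "finite K" "card J < card K"
    and \<Phi>: "\<And>k. k \<in> K \<Longrightarrow> bounded_degree J D (\<Phi> k)"
  shows "\<exists>N c y. (\<forall>z. (\<Sum>\<alpha>\<in>K \<rightarrow>\<^sub>E {..<N}. c \<alpha> * (\<Prod>k\<in>K. \<Phi> k z ^ \<alpha> k)) = 0) \<and>
    (\<Sum>\<alpha>\<in>K \<rightarrow>\<^sub>E {..<N}. c \<alpha> * (\<Prod>k\<in>K. y k ^ \<alpha> k)) \<noteq> (0 :: real)"
proof -
  \<comment> \<open>A product of powers of the \<open>\<Phi> k\<close> has exponents at most
    \<open>E\<close>, and \<open>E + 1 \<le> N * (card K * D + 1)\<close>. So there are at most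
    \<open>N ^ card J * (card K * D + 1) ^ card J\<close> monomials in \<open>z\<close>, and
    \<open>N\<close> exceeds the second factor, which leaves fewer than
    \<open>N ^ card K\<close>.\<close>
  define N where "N = Suc ((card K * D + 1) ^ card J)"
  define E where "E = card K * (N * D)"
  have fin: "finite (J \<rightarrow>\<^sub>E {..E})" "finite (K \<rightarrow>\<^sub>E {..<N})"
    using assms by (auto intro!: finite_PiE)
  have N: "N \<ge> 1" "(card K * D + 1) ^ card J < N" by (simp_all add: N_def)
  have "card (J \<rightarrow>\<^sub>E {..E}) = (E + 1) ^ card J" using assms by (simp add: card_PiE)
  also have "\<dots> \<le> (N * (card K * D + 1)) ^ card J"
    using N(1) by (intro power_mono) (auto simp: E_def algebra_simps)
  also have "\<dots> = N ^ card J * (card K * D + 1) ^ card J" by (rule power_mult_distrib)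
  also have "\<dots> < N ^ card J * N" using N by (intro mult_strict_left_mono) auto
  also have "\<dots> \<le> N ^ card K"
    using assms(3) power_increasing[of "Suc (card J)" "card K" N] N(1) by (simp add: mult.commute)
  also have "\<dots> = card (K \<rightarrow>\<^sub>E {..<N})" using assms by (simp add: card_PiE)
  finally have less: "card (J \<rightarrow>\<^sub>E {..E}) < card (K \<rightarrow>\<^sub>E {..<N})" .
  have "\<exists>A. \<forall>z. (\<Prod>k\<in>K. \<Phi> k z ^ \<alpha> k) = (\<Sum>\<beta>\<in>J \<rightarrow>\<^sub>E {..E}. A \<beta> * (\<Prod>j\<in>J. z j ^ \<beta> j))"
    if "\<alpha> \<in> K \<rightarrow>\<^sub>E {..<N}" for \<alpha>
  proof (rule bounded_degree_expansion[OF _ assms(1)])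
    show "bounded_degree J E (\<lambda>z. \<Prod>k\<in>K. \<Phi> k z ^ \<alpha> k)"
      unfolding E_def
    proof (rule bounded_degree_prod[OF assms(2)])
      fix k assume k: "k \<in> K"
      have "\<alpha> k * D \<le> N * D" using that k by (intro mult_right_mono) (auto simp: PiE_iff)
      with bounded_degree_power[OF \<Phi>[OF k]] show "bounded_degree J (N * D) (\<lambda>z. \<Phi> k z ^ \<alpha> k)"
        by (rule bounded_degree_mono)
    qed
  qed
  then have "\<forall>\<alpha>\<in>K \<rightarrow>\<^sub>E {..<N}. \<exists>A. \<forall>z. (\<Prod>k\<in>K. \<Phi> k z ^ \<alpha> k) = (\<Sum>\<beta>\<in>J \<rightarrow>\<^sub>E {..E}. A \<beta> * (\<Prod>j\<in>J. z j ^ \<beta> j))"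
    by (rule ballI)
  from bchoice[OF this] obtain A where A: "\<And>\<alpha> z. \<alpha> \<in> K \<rightarrow>\<^sub>E {..<N} \<Longrightarrow>
      (\<Prod>k\<in>K. \<Phi> k z ^ \<alpha> k) = (\<Sum>\<beta>\<in>J \<rightarrow>\<^sub>E {..E}. A \<alpha> \<beta> * (\<Prod>j\<in>J. z j ^ \<beta> j))"
    by blast
  \<comment> \<open>One equation for each monomial \<open>\<beta>\<close> in \<open>z\<close>: all
    coefficients of the combination vanish.\<close>
  obtain c where c: "\<exists>\<alpha>\<in>K \<rightarrow>\<^sub>E {..<N}. c \<alpha> \<noteq> 0"
    "\<forall>\<beta>\<in>J \<rightarrow>\<^sub>E {..E}. (\<Sum>\<alpha>\<in>K \<rightarrow>\<^sub>E {..<N}. A \<alpha> \<beta> * c \<alpha>) = 0"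
    using underdetermined_system[OF fin less, of "\<lambda>\<beta> \<alpha>. A \<alpha> \<beta>"] by blast
  have "(\<Sum>\<alpha>\<in>K \<rightarrow>\<^sub>E {..<N}. c \<alpha> * (\<Prod>k\<in>K. \<Phi> k z ^ \<alpha> k)) = 0" for z
  proof -
    have "(\<Sum>\<alpha>\<in>K \<rightarrow>\<^sub>E {..<N}. c \<alpha> * (\<Prod>k\<in>K. \<Phi> k z ^ \<alpha> k))
        = (\<Sum>\<alpha>\<in>K \<rightarrow>\<^sub>E {..<N}. \<Sum>\<beta>\<in>J \<rightarrow>\<^sub>E {..E}. c \<alpha> * (A \<alpha> \<beta> * (\<Prod>j\<in>J. z j ^ \<beta> j)))"
      by (intro sum.cong) (auto simp: A sum_distrib_left)
    also have "\<dots> = (\<Sum>\<beta>\<in>J \<rightarrow>\<^sub>E {..E}. (\<Prod>j\<in>J. z j ^ \<beta> j) * (\<Sum>\<alpha>\<in>K \<rightarrow>\<^sub>E {..<N}. A \<alpha> \<beta> * c \<alpha>))"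
      by (subst sum.swap) (simp add: sum_distrib_left mult_ac)
    also have "\<dots> = 0" using c(2) by simp
    finally show ?thesis .
  qed
  moreover obtain y where "(\<Sum>\<alpha>\<in>K \<rightarrow>\<^sub>E {..<N}. c \<alpha> * (\<Prod>k\<in>K. y k ^ \<alpha> k)) \<noteq> 0"
    using nonzero_coefficients_nonroot[OF assms(2)] c(1) by blast
  ultimately show ?thesis by blast
qed

subsection \<open>Polynomial functions of the parameters\<close>

lemma param_polynomial_diff:
  assumes "param_polynomial G f" "param_polynomial G h"
  shows "param_polynomial G (\<lambda>x. f x - h x)"
  using param_polynomial.add[OF assms(1) param_polynomial.mult[OF param_polynomial.const[of G "-1"] assms(2)]]
  by simp

lemma param_polynomial_power:
  "param_polynomial G f \<Longrightarrow> param_polynomial G (\<lambda>x. f x ^ n)"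
  by (induction n) (simp_all add: param_polynomial.const param_polynomial.mult)

lemma param_polynomial_sum:
  "finite K \<Longrightarrow> (\<And>k. k \<in> K \<Longrightarrow> param_polynomial G (f k)) \<Longrightarrow> param_polynomial G (\<lambda>x. \<Sum>k\<in>K. f k x)"
  by (induction K rule: finite_induct) (simp_all add: param_polynomial.const param_polynomial.add)

lemma param_polynomial_prod:
  "finite K \<Longrightarrow> (\<And>k. k \<in> K \<Longrightarrow> param_polynomial G (f k)) \<Longrightarrow> param_polynomial G (\<lambda>x. \<Prod>k\<in>K. f k x)"
  by (induction K rule: finite_induct) (simp_all add: param_polynomial.const param_polynomial.mult)

text \<open>Nonroots are constructed among arbitrary functions; this moves them into
  \<open>param_space\<close>, whose elements are extensional.\<close>

lemma param_polynomial_restrict: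
  assumes "param_polynomial G f"
  shows "f (restrict d (edges G), restrict s (loops G)) = f (d, s)"
  using assms by induction auto

text \<open>Restriction to a line reduces nonvanishing to polynomials in one variable. It serves for
  products of polynomials and for turning the direction of a single edge.\<close>

lemma param_polynomial_on_line:
  assumes "param_polynomial G f"
  shows "\<exists>p :: real poly. \<forall>t. f (\<lambda>e. a e + t *\<^sub>R b e, \<lambda>l. a' l + t * b' l) = poly p t"
  using assms
proof induction
  case (dir_coord e k)
  show ?case by (intro exI[of _ "[:a e $ k, b e $ k:]"]) simp
next
  case (slider_coord l)
  show ?case by (intro exI[of _ "[:a' l, b' l:]"]) simp
next
  case (const c)
  show ?case by (intro exI[of _ "[:c:]"]) simp
next
  case (add f h)
  then obtain p q where
    "\<forall>t. f (\<lambda>e. a e + t *\<^sub>R b e, \<lambda>l. a' l + t * b' l) = poly p t"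
    "\<forall>t. h (\<lambda>e. a e + t *\<^sub>R b e, \<lambda>l. a' l + t * b' l) = poly q t" by blast
  then show ?case by (intro exI[of _ "p + q"]) simp
next
  case (mult f h)
  then obtain p q where
    "\<forall>t. f (\<lambda>e. a e + t *\<^sub>R b e, \<lambda>l. a' l + t * b' l) = poly p t"
    "\<forall>t. h (\<lambda>e. a e + t *\<^sub>R b e, \<lambda>l. a' l + t * b' l) = poly q t" by blast
  then show ?case by (intro exI[of _ "p * q"]) simp
qed

text \<open>On the line through \<open>x\<close> and \<open>y\<close> neither factor vanishes
  identically, and the product of two nonzero real polynomials has a nonroot.\<close>

lemma param_polynomial_mult_nonzero:
  assumes f: "param_polynomial G f" "f x \<noteq> 0" and h: "param_polynomial G h" "h y \<noteq> 0"
  shows "\<exists>z. f z * h z \<noteq> 0"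
proof -
  obtain a a' where x: "x = (a, a')" by (cases x)
  obtain b b' where y: "y = (b, b')" by (cases y)
  define line where "line t = (\<lambda>e. a e + t *\<^sub>R (b e - a e), \<lambda>l. a' l + t * (b' l - a' l))" for t :: real
  have ends: "line 0 = x" "line 1 = y" by (simp_all add: line_def x y)
  obtain p where p: "\<forall>t. f (line t) = poly p t"
    unfolding line_def
    using param_polynomial_on_line[OF f(1), of a "\<lambda>e. b e - a e" a' "\<lambda>l. b' l - a' l"] by blast
  obtain q where q: "\<forall>t. h (line t) = poly q t"
    unfolding line_def
    using param_polynomial_on_line[OF h(1), of a "\<lambda>e. b e - a e" a' "\<lambda>l. b' l - a' l"] by blast
  have "poly p 0 \<noteq> 0" "poly q 1 \<noteq> 0"
    using f(2) h(2) p[rule_format, of 0] q[rule_format, of 1] unfolding ends by simp_all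
  then have "p \<noteq> 0" "q \<noteq> 0" by auto
  then obtain t where "poly (p * q) t \<noteq> 0" using nonzero_poly_nonroot[of "p * q"] by auto
  then show ?thesis using p q by (intro exI[of _ "line t"]) simp
qed

lemma param_polynomial_prod_nonzero:
  assumes "finite K" "\<And>k. k \<in> K \<Longrightarrow> param_polynomial G (f k)" "\<And>k. k \<in> K \<Longrightarrow> \<exists>x. f k x \<noteq> 0"
  shows "\<exists>x. (\<Prod>k\<in>K. f k x) \<noteq> 0"
  using assms
proof (induction K rule: finite_induct)
  case empty
  then show ?case by simp
next
  case (insert k K)
  then obtain x y where "f k x \<noteq> 0" "(\<Prod>k\<in>K. f k y) \<noteq> 0" by blast
  then have "\<exists>z. f k z * (\<Prod>k\<in>K. f k z) \<noteq> 0"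
    using insert.prems(1) insert.hyps(1)
    by (intro param_polynomial_mult_nonzero[where x = x and y = y] param_polynomial_prod) auto
  then show ?case using insert.hyps by simp
qed

lemma nonvanishing_complement_proper_algebraic:
  assumes "param_polynomial G g" "g x \<noteq> 0"
  shows "proper_algebraic_subset G {x \<in> param_space G. g x = 0}"
proof -
  obtain d s where x: "x = (d, s)" by (cases x)
  let ?y = "(restrict d (edges G), restrict s (loops G))"
  have "?y \<in> param_space G" by (simp add: param_space_def)
  moreover have "g ?y \<noteq> 0" using assms(2) by (simp only: param_polynomial_restrict[OF assms(1)] x not_False_eq_True)
  moreover have "algebraic_subset G {x \<in> param_space G. g x = 0}"
    unfolding algebraic_subset_def using assms(1) by (intro exI[of _ "{g}"]) simp
  ultimately show ?thesis unfolding proper_algebraic_subset_def by blast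
qed

section \<open>Coordinates of the vertices and the equations as linear forms\<close>

lemma UNIV_color: "(UNIV :: color set) = {Red, Blue}"
proof -
  have "c \<in> {Red, Blue}" for c by (cases c) simp_all
  then show ?thesis by (auto simp only: UNIV_eq_I)
qed

lemma finite_UNIV_color [simp]: "finite (UNIV :: color set)"
  by (simp add: UNIV_color)

lemma card_UNIV_color [simp]: "card (UNIV :: color set) = 2"
  by (simp add: UNIV_color)

lemma sum_times_color:
  "sum f (A \<times> (UNIV :: color set)) = (\<Sum>v\<in>A. f (v, Red) + f (v, Blue))"
proof -
  have "sum f (A \<times> (UNIV :: color set)) = (\<Sum>v\<in>A. \<Sum>c\<in>UNIV. f (v, c))"
    by (simp add: sum.cartesian_product)
  then show ?thesis by (simp add: UNIV_color)
qed

text \<open>\<open>realization\<close> and \<open>faithful\<close> quantify over both orders of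
  naming the ends of an edge; this removes the quantifier.\<close>

lemma all_doubleton_eq: "(\<forall>i j. {a, b} = {i, j} \<longrightarrow> P i j) \<longleftrightarrow> P a b \<and> P b a"
proof (intro iffI allI impI)
  fix i j assume "P a b \<and> P b a" "{a, b} = {i, j}"
  then show "P i j" unfolding doubleton_eq_iff by (elim disjE) simp_all
qed (simp add: insert_commute)

lemma all_color: "(\<forall>c. P c) \<longleftrightarrow> P Red \<and> P Blue"
proof (intro iffI allI)
  fix c assume "P Red \<and> P Blue"
  then show "P c" by (cases c) simp_all
qed simp

text \<open>A color doubles as the name of the coordinate that its sliders fix, so the unknowns are
  pairs of a vertex and a color.\<close>

primrec coord_index :: "color \<Rightarrow> 2" where
  "coord_index Red = 1"
| "coord_index Blue = 2"

definition coords :: "('v \<Rightarrow> real^2) \<Rightarrow> 'v \<times> color \<Rightarrow> real" where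
  "coords p = (\<lambda>(v, c). p v $ coord_index c)"

lemma vec2_eq_iff_coords: "p v = q w \<longleftrightarrow> (\<forall>c. coords p (v, c) = coords q (w, c))"
  by (simp add: all_color coords_def vec_eq_iff forall_2)

text \<open>An arbitrary orientation, so that each edge contributes a single equation.\<close>

definition tail :: "('v, 'e, 'l) lgraph \<Rightarrow> 'e \<Rightarrow> 'v" where
  "tail G e = (SOME i. \<exists>j. i \<in> verts G \<and> j \<in> verts G \<and> i \<noteq> j \<and> ends G e = {i, j})"

definition head :: "('v, 'e, 'l) lgraph \<Rightarrow> 'e \<Rightarrow> 'v" where
  "head G e = (SOME j. j \<in> verts G \<and> tail G e \<noteq> j \<and> ends G e = {tail G e, j})"

text \<open>The left-hand sides of the equations of a realization, as linear forms in the
  coordinates \<open>u\<close> of the vertices.\<close>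

primrec lhs :: "('v, 'e, 'l) lgraph \<Rightarrow> ('e \<Rightarrow> real^2) \<Rightarrow> 'e + 'l \<Rightarrow> ('v \<times> color \<Rightarrow> real) \<Rightarrow> real" where
  "lhs G d (Inl e) u = (u (tail G e, Blue) - u (head G e, Blue)) * d e $ 1
     - (u (tail G e, Red) - u (head G e, Red)) * d e $ 2"
| "lhs G d (Inr l) u = u (base G l, loop_color G l)"

text \<open>The matrix of the forms \<open>lhs\<close>, since the elimination lemmas speak of
  coefficients.\<close>

primrec coef :: "('v, 'e, 'l) lgraph \<Rightarrow> ('e \<Rightarrow> real^2) \<Rightarrow> 'e + 'l \<Rightarrow> 'v \<times> color \<Rightarrow> real" where
  "coef G d (Inl e) j = (of_bool (fst j = tail G e) - of_bool (fst j = head G e))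
     * (case snd j of Red \<Rightarrow> - d e $ 2 | Blue \<Rightarrow> d e $ 1)"
| "coef G d (Inr l) j = of_bool (j = (base G l, loop_color G l))"

primrec rhs :: "('l \<Rightarrow> real) \<Rightarrow> 'e + 'l \<Rightarrow> real" where
  "rhs s (Inl e) = 0"
| "rhs s (Inr l) = s l"

lemma lhs_add: "lhs G d r (\<lambda>j. u j + w j) = lhs G d r u + lhs G d r w"
  by (cases r) (auto simp: algebra_simps)

lemma lhs_scale: "lhs G d r (\<lambda>j. c * u j) = c * lhs G d r u"
  by (cases r) (auto simp: algebra_simps)

lemma lhs_diff_scale: "lhs G d r (\<lambda>j. a * u j - b * w j) = a * lhs G d r u - b * lhs G d r w"
  by (cases r) (auto simp: algebra_simps)

subsection \<open>The linear system of a network\<close>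

locale looped =
  fixes G :: "('v, 'e, 'l) lgraph"
  assumes looped_graph: "looped_graph G"
begin

lemma finite_graph [simp]: "finite (verts G)" "finite (edges G)" "finite (loops G)"
  using looped_graph by (auto simp: looped_graph_def)

lemma tail_head:
  assumes "e \<in> edges G"
  shows "tail G e \<in> verts G" "head G e \<in> verts G" "tail G e \<noteq> head G e"
    "ends G e = {tail G e, head G e}"
proof -
  have "\<exists>i j. i \<in> verts G \<and> j \<in> verts G \<and> i \<noteq> j \<and> ends G e = {i, j}"
    using looped_graph assms unfolding looped_graph_def by blast
  then have t: "\<exists>j. tail G e \<in> verts G \<and> j \<in> verts G \<and> tail G e \<noteq> j \<and> ends G e = {tail G e, j}"
    unfolding tail_def by (rule someI_ex)
  then have "\<exists>j. j \<in> verts G \<and> tail G e \<noteq> j \<and> ends G e = {tail G e, j}" by blast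
  then have "head G e \<in> verts G \<and> tail G e \<noteq> head G e \<and> ends G e = {tail G e, head G e}"
    unfolding head_def by (rule someI_ex)
  with t show "tail G e \<in> verts G" "head G e \<in> verts G" "tail G e \<noteq> head G e"
    "ends G e = {tail G e, head G e}" by auto
qed

lemma base_in_verts: "l \<in> loops G \<Longrightarrow> base G l \<in> verts G"
  using looped_graph by (auto simp: looped_graph_def)

abbreviation "eqns \<equiv> edges G <+> loops G"
abbreviation "unknowns \<equiv> verts G \<times> (UNIV :: color set)"

lemma card_eqns: "card eqns = card (edges G) + card (loops G)"
  by (simp add: card_Plus)

lemma card_unknowns: "card unknowns = 2 * card (verts G)"
  by (simp add: card_cartesian_product)

lemma lhs_cong:
  assumes "r \<in> eqns" "\<And>j. j \<in> unknowns \<Longrightarrow> u j = w j"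
  shows "lhs G d r u = lhs G d r w"
  using assms by (cases r) (auto simp: tail_head base_in_verts)

text \<open>The sum may run over fewer than all unknowns when \<open>u\<close> vanishes at the
  others; systems on part of the vertices are treated this way.\<close>

lemma sum_coef:
  assumes "r \<in> eqns" "J \<subseteq> unknowns" "\<And>j. j \<in> unknowns - J \<Longrightarrow> u j = 0"
  shows "(\<Sum>j\<in>J. coef G d r j * u j) = lhs G d r u"
proof -
  have delta: "(\<Sum>v\<in>verts G. of_bool (v = w) * f v) = f w"
    if "w \<in> verts G" for w and f :: "'v \<Rightarrow> real"
    using that by (simp add: of_bool_def if_distrib[of "\<lambda>x. x * _"] cong: if_cong)
  have "(\<Sum>j\<in>J. coef G d r j * u j) = (\<Sum>j\<in>unknowns. coef G d r j * u j)"
    using assms by (intro sum.mono_neutral_left) auto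
  also have "\<dots> = lhs G d r u"
  proof (cases r)
    case (Inl e)
    then have e: "e \<in> edges G" using assms by auto
    have "(\<Sum>j\<in>unknowns. coef G d r j * u j)
      = (\<Sum>v\<in>verts G. coef G d r (v, Red) * u (v, Red) + coef G d r (v, Blue) * u (v, Blue))"
      by (rule sum_times_color)
    also have "\<dots>
      = (\<Sum>v\<in>verts G. of_bool (v = tail G e) * (d e $ 1 * u (v, Blue) - d e $ 2 * u (v, Red)))
      - (\<Sum>v\<in>verts G. of_bool (v = head G e) * (d e $ 1 * u (v, Blue) - d e $ 2 * u (v, Red)))"
      unfolding sum_subtractf[symmetric] by (intro sum.cong) (auto simp: Inl algebra_simps)
    also have "\<dots> = lhs G d r u"
      unfolding delta[OF tail_head(1)[OF e]] delta[OF tail_head(2)[OF e]] by (simp add: Inl algebra_simps)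
    finally show ?thesis .
  next
    case (Inr l)
    then have mem: "(base G l, loop_color G l) \<in> unknowns" using assms by (auto simp: base_in_verts)
    have "(\<Sum>j\<in>unknowns. coef G d r j * u j)
        = (\<Sum>j\<in>unknowns. if j = (base G l, loop_color G l) then u j else 0)"
      by (intro sum.cong) (auto simp: Inr)
    also have "\<dots> = lhs G d r u" using mem by (subst sum.delta) (simp_all add: Inr)
    finally show ?thesis .
  qed
  finally show ?thesis .
qed

lemma system_iff:
  "(\<forall>r\<in>eqns. (\<Sum>j\<in>unknowns. coef G d r j * u j) = b r) \<longleftrightarrow> (\<forall>r\<in>eqns. lhs G d r u = b r)"
proof (rule ball_cong[OF refl])
  fix r assume "r \<in> eqns"
  then have "(\<Sum>j\<in>unknowns. coef G d r j * u j) = lhs G d r u" by (rule sum_coef) simp_all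
  then show "(\<Sum>j\<in>unknowns. coef G d r j * u j) = b r \<longleftrightarrow> lhs G d r u = b r" by (rule arg_cong)
qed

text \<open>Only the homogeneous system matters, so slider positions do not enter. \<open>R\<close>
  is a parameter in order to study the system with an equation removed.\<close>

definition pinned :: "('e \<Rightarrow> real^2) \<Rightarrow> ('e + 'l) set \<Rightarrow> bool" where
  "pinned d R \<longleftrightarrow> (\<forall>u. (\<forall>r\<in>R. lhs G d r u = 0) \<longrightarrow> (\<forall>j\<in>unknowns. u j = 0))"

lemma underdetermined_eqns:
  assumes "R \<subseteq> eqns" "J \<subseteq> unknowns" "card R < card J"
  shows "\<exists>u. (\<exists>j\<in>J. u j \<noteq> 0) \<and> (\<forall>j. j \<notin> J \<longrightarrow> u j = 0) \<and> (\<forall>r\<in>R. lhs G d r u = 0)"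
proof -
  have "finite R" by (rule finite_subset[OF assms(1)]) simp
  moreover have "finite J" by (rule finite_subset[OF assms(2)]) simp
  ultimately obtain u where
    u: "\<exists>j\<in>J. u j \<noteq> 0" "\<forall>j. j \<notin> J \<longrightarrow> u j = 0" "\<forall>r\<in>R. (\<Sum>j\<in>J. coef G d r j * u j) = 0"
    using underdetermined_system[OF _ _ assms(3), of "coef G d"] by blast
  have "lhs G d r u = 0" if "r \<in> R" for r
    using u(2,3) that assms(1) sum_coef[OF _ assms(2), of r u d] by auto
  with u show ?thesis by blast
qed

lemma pinned_card:
  assumes "R \<subseteq> eqns" "pinned d R"
  shows "2 * card (verts G) \<le> card R"
proof (rule ccontr)
  assume "\<not> ?thesis"
  then have "card R < card unknowns" by (simp only: card_unknowns not_le)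
  from underdetermined_eqns[OF assms(1) order_refl this] assms(2) show False
    unfolding pinned_def by blast
qed

lemma realization_iff_eqns:
  "realization G d s p \<longleftrightarrow>
     p \<in> verts G \<rightarrow>\<^sub>E UNIV \<and> (\<forall>r\<in>eqns. lhs G d r (coords p) = rhs s r)"
proof -
  have edge: "(\<forall>i j. ends G e = {i, j} \<longrightarrow> (p i - p j) \<bullet> perp (d e) = 0)
      \<longleftrightarrow> lhs G d (Inl e) (coords p) = 0" if "e \<in> edges G" for e
  proof -
    have inner: "(p i - p j) \<bullet> perp (d e) = (p i $ 2 - p j $ 2) * d e $ 1 - (p i $ 1 - p j $ 1) * d e $ 2" for i j
      by (simp add: perp_def inner_vec_def sum_2 algebra_simps)
    show ?thesis
      unfolding inner tail_head(4)[OF that] all_doubleton_eq by (simp add: coords_def) (auto simp: algebra_simps)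
  qed
  have loop: "(loop_color G l = Red \<longrightarrow> p (base G l) $ 1 = s l) \<and>
      (loop_color G l = Blue \<longrightarrow> p (base G l) $ 2 = s l)
      \<longleftrightarrow> lhs G d (Inr l) (coords p) = s l" for l
    by (cases "loop_color G l") (auto simp: coords_def)
  have edges: "(\<forall>e\<in>edges G. \<forall>i j. ends G e = {i, j} \<longrightarrow> (p i - p j) \<bullet> perp (d e) = 0)
      \<longleftrightarrow> (\<forall>e\<in>edges G. lhs G d (Inl e) (coords p) = rhs s (Inl e))"
    by (intro ball_cong refl) (simp only: edge rhs.simps)
  have loops: "(\<forall>l\<in>loops G. loop_color G l = Red \<longrightarrow> p (base G l) $ 1 = s l) \<and>
      (\<forall>l\<in>loops G. loop_color G l = Blue \<longrightarrow> p (base G l) $ 2 = s l)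
      \<longleftrightarrow> (\<forall>l\<in>loops G. lhs G d (Inr l) (coords p) = rhs s (Inr l))"
    unfolding rhs.simps loop[symmetric] by blast
  have eqns: "(\<forall>r\<in>eqns. P r) \<longleftrightarrow> (\<forall>e\<in>edges G. P (Inl e)) \<and> (\<forall>l\<in>loops G. P (Inr l))" for P
    by blast
  show ?thesis unfolding realization_def edges eqns using loops by simp
qed

lemma realization_eqn:
  assumes "realization G d s p" "r \<in> eqns"
  shows "lhs G d r (coords p) = rhs s r"
  using assms(1)[unfolded realization_iff_eqns, THEN conjunct2] assms(2) by (rule bspec)

lemma faithful_iff: "faithful G p \<longleftrightarrow> (\<forall>e\<in>edges G. p (tail G e) \<noteq> p (head G e))"
  unfolding faithful_def
proof (rule ball_cong[OF refl])
  fix e assume "e \<in> edges G"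
  then show "(\<forall>i j. ends G e = {i, j} \<longrightarrow> p i \<noteq> p j) \<longleftrightarrow> p (tail G e) \<noteq> p (head G e)"
    unfolding tail_head(4)[OF \<open>e \<in> edges G\<close>] all_doubleton_eq by auto
qed

definition place :: "('v \<times> color \<Rightarrow> real) \<Rightarrow> 'v \<Rightarrow> real^2" where
  "place u = (\<lambda>v\<in>verts G. vector [u (v, Red), u (v, Blue)])"

lemma coords_place:
  assumes "j \<in> unknowns"
  shows "coords (place u) j = u j"
proof -
  obtain v c where "j = (v, c)" by (cases j)
  with assms show ?thesis by (cases c) (simp_all add: coords_def place_def)
qed

lemma realization_place:
  "realization G d s (place u) \<longleftrightarrow> (\<forall>r\<in>eqns. lhs G d r u = rhs s r)"
proof -
  have "lhs G d r (coords (place u)) = lhs G d r u" if "r \<in> eqns" for r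
    using that by (intro lhs_cong coords_place)
  moreover have "place u \<in> verts G \<rightarrow>\<^sub>E UNIV" by (simp add: place_def)
  ultimately show ?thesis unfolding realization_iff_eqns by simp
qed

text \<open>A kernel vector \<open>w\<close> moves a faithful realization \<open>p\<close> along a
  line \<open>p + t w\<close> of realizations. Each edge collapses for at most one \<open>t\<close>,
  so some \<open>t\<close> other than 0 gives a faithful one; uniqueness then makes \<open>w\<close>
  vanish on the unknowns.\<close>

lemma unique_faithful_imp_pinned:
  assumes "\<exists>!p. realization G d s p \<and> faithful G p"
  shows "pinned d eqns"
  unfolding pinned_def
proof (intro allI impI)
  fix w assume w: "\<forall>r\<in>eqns. lhs G d r w = 0"
  obtain p where p: "realization G d s p" "faithful G p"
    and uniq: "\<And>q. realization G d s q \<Longrightarrow> faithful G q \<Longrightarrow> q = p"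
    using assms by blast
  define u where "u t = (\<lambda>j. coords p j + t * w j)" for t :: real
  have "\<forall>r\<in>eqns. lhs G d r (coords p) = rhs s r" using p(1) by (simp add: realization_iff_eqns)
  then have real_t: "realization G d s (place (u t))" for t
    unfolding realization_place using w by (simp add: u_def lhs_add lhs_scale)
  have "\<exists>b. \<forall>t. t \<noteq> b \<longrightarrow> t = 0 \<or> place (u t) (tail G e) \<noteq> place (u t) (head G e)"
    if e: "e \<in> edges G" for e
  proof -
    have "p (tail G e) \<noteq> p (head G e)" using p(2) e by (simp add: faithful_iff)
    then obtain c where c: "coords p (tail G e, c) \<noteq> coords p (head G e, c)"
      unfolding vec2_eq_iff_coords[of p _ p] by blast
    let ?a = "coords p (tail G e, c) - coords p (head G e, c)"
    let ?w = "w (tail G e, c) - w (head G e, c)"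
    have "t = - ?a / ?w" if "place (u t) (tail G e) = place (u t) (head G e)" for t
    proof -
      have "coords (place (u t)) (tail G e, c) = coords (place (u t)) (head G e, c)"
        using that unfolding vec2_eq_iff_coords[of "place (u t)" _ "place (u t)"] by blast
      then have "u t (tail G e, c) = u t (head G e, c)"
        using tail_head[OF e] by (simp add: coords_place)
      then have "t * ?w = - ?a" by (simp add: u_def algebra_simps)
      moreover have "?a \<noteq> 0" using c by simp
      ultimately have "?w \<noteq> 0" by auto
      with \<open>t * ?w = - ?a\<close> show ?thesis by (metis nonzero_mult_div_cancel_right)
    qed
    then show ?thesis by blast
  qed
  then obtain b where b: "\<And>e t. e \<in> edges G \<Longrightarrow> t \<noteq> b e \<Longrightarrow> t \<noteq> 0 \<Longrightarrow>
      place (u t) (tail G e) \<noteq> place (u t) (head G e)" by metis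
  have "finite (insert 0 (b ` edges G))" by simp
  then obtain t where t: "t \<notin> insert 0 (b ` edges G)"
    using ex_new_if_finite[OF infinite_UNIV_char_0] by blast
  then have "faithful G (place (u t))" using b by (auto simp: faithful_iff)
  then have eq: "place (u t) = p" using uniq real_t by blast
  show "\<forall>j\<in>unknowns. w j = 0"
  proof
    fix j assume "j \<in> unknowns"
    from coords_place[OF this, of "u t"] have "t * w j = 0" unfolding eq by (simp add: u_def)
    with t show "w j = 0" by simp
  qed
qed

end

subsection \<open>Networks with faithful realizations are sparse\<close>

lemma bounded_degree_diff:
  assumes "bounded_degree J D f" "bounded_degree J D g"
  shows "bounded_degree J D (\<lambda>z. f z - g z)"
proof -
  have "bounded_degree J D (\<lambda>z. - g z)"
    using bounded_degree_mult[OF bounded_degree_const[of J 0 "-1"] assms(2)] by simp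
  from bounded_degree.add[OF assms(1) this] show ?thesis by simp
qed

context looped
begin

text \<open>Positions of the vertices in \<open>X\<close> and scale factors of the edges in \<open>Y\<close> are the
  parameters; the other positions are \<open>0\<close> and the other factors \<open>1\<close>.\<close>

lemma parametrized_networks_nongeneric:
  assumes "E \<subseteq> edges G" "L \<subseteq> loops G" "finite X" "finite Y"
    and less: "2 * card X + card Y < 2 * card E + card L"
  shows "\<exists>g x. param_polynomial G g \<and> g x \<noteq> 0 \<and>
    (\<forall>d s u t. (\<forall>v c. v \<notin> X \<longrightarrow> u (v, c) = 0) \<longrightarrow> (\<forall>e\<in>E - Y. t e = 1) \<longrightarrow>
      (\<forall>e\<in>E. \<forall>c. d e $ coord_index c = t e * (u (tail G e, c) - u (head G e, c))) \<longrightarrow>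
      (\<forall>l\<in>L. s l = u (base G l, loop_color G l)) \<longrightarrow> g (d, s) = 0)"
proof -
  \<comment> \<open>\<open>J\<close> indexes the free parameters and \<open>K\<close> the
    coordinates of the network; \<open>\<Phi>\<close> computes the latter from the former, and
    \<open>param\<close> reads them off a given network.\<close>
  define J where "J = X \<times> (UNIV :: color set) <+> Y"
  define K where "K = E \<times> (UNIV :: color set) <+> L"
  define pos where "pos v c = (\<lambda>z :: ('v \<times> color) + 'e \<Rightarrow> real. if v \<in> X then z (Inl (v, c)) else 0)" for v c
  define fac where "fac e = (\<lambda>z :: ('v \<times> color) + 'e \<Rightarrow> real. if e \<in> Y then z (Inr e) else 1)" for e
  define \<Phi> where "\<Phi> = case_sum (\<lambda>(e, c) z. fac e z * (pos (tail G e) c z - pos (head G e) c z))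
      (\<lambda>l. pos (base G l) (loop_color G l))"
  define param where "param = case_sum (\<lambda>(e, c) (d :: 'e \<Rightarrow> real^2, s :: 'l \<Rightarrow> real). d e $ coord_index c)
      (\<lambda>l (d, s). s l)"
  have fin: "finite E" "finite L"
    by (rule finite_subset[OF assms(1)], simp) (rule finite_subset[OF assms(2)], simp)
  then have finJK: "finite J" "finite K" using assms(3,4) by (simp_all add: J_def K_def)
  have "card J < card K"
    using fin assms(3-5) by (simp add: J_def K_def card_Plus card_cartesian_product)
  have memJ: "Inl (v, c) \<in> J" if "v \<in> X" for v c using that by (simp add: J_def InlI)
  have "Inr e \<in> J" if "e \<in> Y" for e using that by (simp add: J_def InrI)
  note memJ = memJ this
  have pos: "bounded_degree J 1 (pos v c)" for v c
    using bounded_degree_coordinate[OF finJK(1), of "Inl (v, c)"] bounded_degree_const[of J 1 0]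
    by (cases "v \<in> X") (simp_all add: pos_def memJ)
  have fac: "bounded_degree J 1 (fac e)" for e
    using bounded_degree_coordinate[OF finJK(1), of "Inr e"] bounded_degree_const[of J 1 1]
    by (cases "e \<in> Y") (simp_all add: fac_def memJ)
  have \<Phi>: "bounded_degree J 2 (\<Phi> k)" for k
  proof (cases k)
    case (Inl a)
    obtain e c where "a = (e, c)" by (cases a)
    then show ?thesis
      using bounded_degree_mult[OF fac[of e] bounded_degree_diff[OF pos[of "tail G e" c] pos[of "head G e" c]]]
      by (simp add: Inl \<Phi>_def numeral_2_eq_2)
  next
    case (Inr l)
    then show ?thesis using bounded_degree_mono[OF pos, of 2] by (simp add: \<Phi>_def)
  qed
  from algebraic_dependence[OF finJK \<open>card J < card K\<close>, of 2 \<Phi>, OF \<Phi>] obtain N c y where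
    vanish: "\<forall>z. (\<Sum>\<alpha>\<in>K \<rightarrow>\<^sub>E {..<N}. c \<alpha> * (\<Prod>k\<in>K. \<Phi> k z ^ \<alpha> k)) = 0"
    and nonzero: "(\<Sum>\<alpha>\<in>K \<rightarrow>\<^sub>E {..<N}. c \<alpha> * (\<Prod>k\<in>K. y k ^ \<alpha> k)) \<noteq> 0"
    by blast
  define g where "g = (\<lambda>x. \<Sum>\<alpha>\<in>K \<rightarrow>\<^sub>E {..<N}. c \<alpha> * (\<Prod>k\<in>K. param k x ^ \<alpha> k))"
  have "param_polynomial G (param k)" if "k \<in> K" for k
  proof (cases k)
    case (Inl a)
    obtain e c where "a = (e, c)" by (cases a)
    then show ?thesis
      using that assms(1) param_polynomial.dir_coord[of e G "coord_index c"]
      by (auto simp: K_def param_def Inl)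
  next
    case (Inr l)
    then show ?thesis
      using that assms(2) param_polynomial.slider_coord[of l G] by (auto simp: K_def param_def)
  qed
  then have "param_polynomial G g"
    unfolding g_def using finJK
    by (intro param_polynomial_sum param_polynomial.mult param_polynomial.const
        param_polynomial_prod param_polynomial_power) (auto intro!: finite_PiE)
  \<comment> \<open>The point \<open>y\<close>, at which the dependence relation is nonzero, is read
    as a network.\<close>
  moreover have "g (\<lambda>e. vector [y (Inl (e, Red)), y (Inl (e, Blue))], \<lambda>l. y (Inr l)) \<noteq> 0" (is "g ?x \<noteq> 0")
  proof -
    have "param k ?x = y k" for k
    proof (cases k)
      case (Inl a)
      obtain e c where "a = (e, c)" by (cases a)
      then show ?thesis by (cases c) (simp_all add: param_def Inl)
    qed (simp add: param_def)
    then show ?thesis using nonzero by (simp add: g_def)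
  qed
  moreover have "g (d, s) = 0"
    if u: "\<forall>v c. v \<notin> X \<longrightarrow> u (v, c) = 0" and t: "\<forall>e\<in>E - Y. t e = 1"
      and d: "\<forall>e\<in>E. \<forall>c. d e $ coord_index c = t e * (u (tail G e, c) - u (head G e, c))"
      and s: "\<forall>l\<in>L. s l = u (base G l, loop_color G l)" for d s u t
  proof -
    let ?z = "case_sum u t"
    have "pos v c ?z = u (v, c)" for v c using u by (simp add: pos_def)
    moreover have "fac e ?z = t e" if "e \<in> E" for e using t that by (simp add: fac_def)
    ultimately have "param k (d, s) = \<Phi> k ?z" if "k \<in> K" for k
      using that d s by (auto simp: K_def param_def \<Phi>_def)
    then have "g (d, s) = (\<Sum>\<alpha>\<in>K \<rightarrow>\<^sub>E {..<N}. c \<alpha> * (\<Prod>k\<in>K. \<Phi> k ?z ^ \<alpha> k))"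
      by (simp add: g_def)
    then show ?thesis using vanish by simp
  qed
  ultimately show ?thesis by blast
qed

text \<open>The edge equation makes \<open>d e\<close> parallel to the difference of the ends, and
  faithfulness makes this difference nonzero. The factor is on this side because \<open>d e\<close>
  may be zero.\<close>

lemma faithful_edge_direction:
  assumes "realization G d s p" "faithful G p" "e \<in> edges G"
  shows "\<exists>t. \<forall>c. d e $ coord_index c = t * (coords p (tail G e, c) - coords p (head G e, c))"
proof -
  define \<delta> where "\<delta> c = coords p (tail G e, c) - coords p (head G e, c)" for c
  have "p (tail G e) \<noteq> p (head G e)" using assms by (simp add: faithful_iff)
  then have nz: "\<delta> Red \<noteq> 0 \<or> \<delta> Blue \<noteq> 0" unfolding vec2_eq_iff_coords[of p _ p] all_color \<delta>_def by auto
  have "lhs G d (Inl e) (coords p) = 0"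
    using realization_eqn[OF assms(1) InlI[OF assms(3)]] by simp
  then have eq: "\<delta> Blue * d e $ 1 = \<delta> Red * d e $ 2" by (simp add: \<delta>_def)
  show ?thesis unfolding \<delta>_def[symmetric]
  proof (cases "\<delta> Red = 0")
    case True
    with nz eq show "\<exists>t. \<forall>c. d e $ coord_index c = t * \<delta> c"
      unfolding all_color by (intro exI[of _ "d e $ 2 / \<delta> Blue"]) simp
  next
    case False
    with eq show "\<exists>t. \<forall>c. d e $ coord_index c = t * \<delta> c"
      unfolding all_color by (intro exI[of _ "d e $ 1 / \<delta> Red"]) (simp add: field_simps)
  qed
qed

text \<open>Positions in \<open>V\<close> and one factor for each edge of \<open>E\<close> are
  \<open>2|V| + |E|\<close> parameters, but \<open>E\<close> and \<open>L\<close> carry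
  \<open>2|E| + |L|\<close> coordinates of the network.\<close>

lemma too_many_equations_nongeneric:
  assumes "subgraph V E L G" "2 * card V < card E + card L"
  shows "\<exists>g x. param_polynomial G g \<and> g x \<noteq> 0 \<and>
    (\<forall>d s p. realization G d s p \<longrightarrow> faithful G p \<longrightarrow> g (d, s) = 0)"
proof -
  have sub: "V \<subseteq> verts G" "E \<subseteq> edges G" "L \<subseteq> loops G" "\<And>e. e \<in> E \<Longrightarrow> ends G e \<subseteq> V"
    "\<And>l. l \<in> L \<Longrightarrow> base G l \<in> V" using assms(1) by (auto simp: subgraph_def)
  have "finite V" by (rule finite_subset[OF sub(1)]) simp
  moreover have "finite E" by (rule finite_subset[OF sub(2)]) simp
  moreover have "2 * card V + card E < 2 * card E + card L" using assms(2) by simp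
  ultimately obtain g x where g: "param_polynomial G g" "g x \<noteq> 0"
    and van: "\<forall>d s u t. (\<forall>v c. v \<notin> V \<longrightarrow> u (v, c) = 0) \<longrightarrow> (\<forall>e\<in>E - E. t e = 1) \<longrightarrow>
      (\<forall>e\<in>E. \<forall>c. d e $ coord_index c = t e * (u (tail G e, c) - u (head G e, c))) \<longrightarrow>
      (\<forall>l\<in>L. s l = u (base G l, loop_color G l)) \<longrightarrow> g (d, s) = 0"
    using parametrized_networks_nongeneric[OF sub(2,3), of V E] by blast
  have "g (d, s) = 0" if p: "realization G d s p" "faithful G p" for d s p
  proof -
    have "\<forall>e\<in>edges G. \<exists>t. \<forall>c. d e $ coord_index c = t * (coords p (tail G e, c) - coords p (head G e, c))"
      using faithful_edge_direction[OF p] by blast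
    from bchoice[OF this] obtain t where t: "\<And>e c. e \<in> edges G \<Longrightarrow>
      d e $ coord_index c = t e * (coords p (tail G e, c) - coords p (head G e, c))" by blast
    have s: "s l = coords p (base G l, loop_color G l)" if "l \<in> L" for l
    proof -
      have "Inr l \<in> eqns" using that sub(3) by blast
      from realization_eqn[OF p(1) this] show ?thesis by simp
    qed
    have VE: "tail G e \<in> V \<and> head G e \<in> V" if "e \<in> E" for e
      using sub(4)[OF that] tail_head(4)[of e] that sub(2) by auto
    define u where "u j = (if fst j \<in> V then coords p j else 0)" for j
    have "d e $ coord_index c = t e * (u (tail G e, c) - u (head G e, c))" if "e \<in> E" for e c
      using t[of e c] VE[OF that] that sub(2) by (auto simp: u_def)
    moreover have "s l = u (base G l, loop_color G l)" if "l \<in> L" for l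
      using s[OF that] sub(5)[OF that] by (simp add: u_def)
    ultimately show ?thesis
      using van[rule_format, of u t d s] by (simp add: u_def)
  qed
  with g show ?thesis by blast
qed

text \<open>Translation and scaling are used up by placing the tail of one edge at the origin
  and giving this edge the factor \<open>1\<close>.\<close>

lemma too_many_edges_nongeneric:
  assumes "subgraph V E L G" "2 \<le> card V" "2 * int (card V) - 3 < int (card E)"
  shows "\<exists>g x. param_polynomial G g \<and> g x \<noteq> 0 \<and>
    (\<forall>d s p. realization G d s p \<longrightarrow> faithful G p \<longrightarrow> g (d, s) = 0)"
proof -
  have sub: "V \<subseteq> verts G" "E \<subseteq> edges G" "\<And>e. e \<in> E \<Longrightarrow> ends G e \<subseteq> V"
    using assms(1) by (auto simp: subgraph_def)
  have fin: "finite V" "finite E"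
    by (rule finite_subset[OF sub(1)], simp) (rule finite_subset[OF sub(2)], simp)
  have "card E \<noteq> 0" using assms(2,3) by simp
  then obtain e0 where e0: "e0 \<in> E" using fin by fastforce
  let ?o = "tail G e0"
  have VE: "tail G e \<in> V \<and> head G e \<in> V" if "e \<in> E" for e
    using sub(3)[OF that] tail_head(4)[of e] that sub(2) by auto
  \<comment> \<open>The inequality \<open>2(|V| - 1) + |E| - 1 < 2|E|\<close> is exactly the failure
    of \<open>|E| \<le> 2|V| - 3\<close>.\<close>
  have "2 * card (V - {?o}) + card (E - {e0}) < 2 * card E + card ({} :: 'l set)"
    using assms(2,3) e0 VE[OF e0] fin by (simp add: card_Diff_singleton)
  with fin obtain g x where g: "param_polynomial G g" "g x \<noteq> 0"
    and van: "\<forall>d s u t. (\<forall>v c. v \<notin> V - {?o} \<longrightarrow> u (v, c) = 0) \<longrightarrow> (\<forall>e\<in>E - (E - {e0}). t e = 1) \<longrightarrow>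
      (\<forall>e\<in>E. \<forall>c. d e $ coord_index c = t e * (u (tail G e, c) - u (head G e, c))) \<longrightarrow>
      (\<forall>l\<in>{}. s l = u (base G l, loop_color G l)) \<longrightarrow> g (d, s) = 0"
    using parametrized_networks_nongeneric[OF sub(2) empty_subsetI, of "V - {?o}" "E - {e0}"] by blast
  \<comment> \<open>The normalization divides by \<open>t e0\<close>, which can be zero; the factor
    \<open>h\<close> vanishes on such networks.\<close>
  define h where "h = (\<lambda>(d :: 'e \<Rightarrow> real^2, s :: 'l \<Rightarrow> real). d e0 $ 1)"
  have h: "param_polynomial G h" "h (\<lambda>_. 1, \<lambda>_. 0) \<noteq> 0"
    using e0 sub(2) by (auto simp: h_def intro: param_polynomial.dir_coord)
  have "g (d, s) * h (d, s) = 0" if p: "realization G d s p" "faithful G p" for d s p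
  proof (cases "d e0 $ 1 = 0")
    case False
    have "\<forall>e\<in>edges G. \<exists>t. \<forall>c. d e $ coord_index c = t * (coords p (tail G e, c) - coords p (head G e, c))"
      using faithful_edge_direction[OF p] by blast
    from bchoice[OF this] obtain t where t: "\<And>e c. e \<in> edges G \<Longrightarrow>
      d e $ coord_index c = t e * (coords p (tail G e, c) - coords p (head G e, c))" by blast
    have t0: "t e0 \<noteq> 0" using False t[of e0 Red] e0 sub(2) by auto
    define u where "u j = (if fst j \<in> V then t e0 * (coords p j - coords p (?o, snd j)) else 0)" for j
    have "d e $ coord_index c = t e / t e0 * (u (tail G e, c) - u (head G e, c))" if "e \<in> E" for e c
      using t[of e c] VE[OF that] that sub(2) t0 by (auto simp: u_def algebra_simps)
    moreover have "u (v, c) = 0" if "v \<notin> V - {?o}" for v c using that by (auto simp: u_def)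
    moreover have "t e / t e0 = 1" if "e \<in> E - (E - {e0})" for e using that t0 by auto
    ultimately have "g (d, s) = 0" using van[rule_format, of u "\<lambda>e. t e / t e0" d s] by blast
    then show ?thesis by simp
  qed (simp add: h_def)
  note vanish = this
  obtain z where "g z * h z \<noteq> 0" using param_polynomial_mult_nonzero[OF g h] by blast
  with param_polynomial.mult[OF g(1) h(1)] show ?thesis using vanish by blast
qed

end

subsection \<open>Edge colorings from pinned networks\<close>

context looped
begin

text \<open>An edge with direction \<open>axis_dir c\<close> equates the coordinates \<open>c\<close> of its ends.\<close>

definition axis_dir :: "color \<Rightarrow> real^2" where
  "axis_dir c = (case c of Red \<Rightarrow> vector [0, 1] | Blue \<Rightarrow> vector [1, 0])"

lemma lhs_axis_dir: "d e = axis_dir c \<Longrightarrow> lhs G d (Inl e) u = 0 \<longleftrightarrow> u (tail G e, c) = u (head G e, c)"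
  by (cases c) (auto simp: axis_dir_def)

lemma lhs_upd_other: "r \<noteq> Inl e \<Longrightarrow> lhs G (d(e := v)) r u = lhs G d r u"
  by (cases r) auto

text \<open>The kernel of the other equations is at most one-dimensional, and a vector of it that is
  killed by both axis directions is killed by \<open>d e\<close>.\<close>

lemma pinned_axis_dir_edge:
  assumes "pinned d eqns" "e \<in> edges G"
  shows "\<exists>c. pinned (d(e := axis_dir c)) eqns"
proof (rule ccontr)
  assume not: "\<not> ?thesis"
  have "\<exists>u. (\<forall>r\<in>eqns - {Inl e}. lhs G d r u = 0) \<and> u (tail G e, c) = u (head G e, c) \<and>
      (\<exists>j\<in>unknowns. u j \<noteq> 0)" for c
  proof -
    obtain u where u: "\<forall>r\<in>eqns. lhs G (d(e := axis_dir c)) r u = 0" "\<exists>j\<in>unknowns. u j \<noteq> 0"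
      using not unfolding pinned_def by blast
    have "lhs G d r u = 0" if "r \<in> eqns - {Inl e}" for r
      using u(1) that lhs_upd_other[of r e d "axis_dir c" u] by auto
    moreover have "lhs G (d(e := axis_dir c)) (Inl e) u = 0" using u(1) assms(2) by blast
    then have "u (tail G e, c) = u (head G e, c)"
      by (rule lhs_axis_dir[THEN iffD1, rotated]) simp
    ultimately show ?thesis using u(2) by blast
  qed
  then obtain u where u: "\<And>c r. r \<in> eqns - {Inl e} \<Longrightarrow> lhs G d r (u c) = 0"
    "\<And>c. u c (tail G e, c) = u c (head G e, c)" "\<And>c. \<exists>j\<in>unknowns. u c j \<noteq> 0" by metis
  define f where "f c = lhs G d (Inl e) (u c)" for c
  have f: "f c \<noteq> 0" for c
  proof
    assume "f c = 0"
    then have "\<forall>r\<in>eqns. lhs G d r (u c) = 0" using u(1) unfolding f_def by blast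
    with assms(1) u(3)[of c] show False unfolding pinned_def by blast
  qed
  \<comment> \<open>The coefficients are chosen so that the equation of \<open>e\<close> cancels
    too.\<close>
  have "lhs G d r (\<lambda>j. f Blue * u Red j - f Red * u Blue j) = 0" if "r \<in> eqns" for r
    using u(1)[of r Red] u(1)[of r Blue] that
    by (cases "r = Inl e") (simp_all add: lhs_diff_scale f_def del: lhs.simps)
  then have eq: "f Blue * u Red j = f Red * u Blue j" if "j \<in> unknowns" for j
    using assms(1) that unfolding pinned_def by fastforce
  have "f Blue * (u Red (tail G e, Blue) - u Red (head G e, Blue))
      = f Red * (u Blue (tail G e, Blue) - u Blue (head G e, Blue))"
    using eq[of "(tail G e, Blue)"] eq[of "(head G e, Blue)"] tail_head[OF assms(2)]
    by (simp add: right_diff_distrib)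
  \<comment> \<open>The blue coordinate of \<open>u Blue\<close> agrees at the ends of
    \<open>e\<close>, hence so does that of \<open>u Red\<close>. Then \<open>u Red\<close> agrees
    there in both coordinates, which forces \<open>f Red = 0\<close>.\<close>
  then have "u Red (tail G e, Blue) - u Red (head G e, Blue) = 0"
    using f[of Blue] u(2)[of Blue] by simp
  then have "f Red = 0" using u(2)[of Red] by (simp add: f_def)
  then show False using f by blast
qed

lemma pinned_imp_axis_pinned:
  assumes "pinned d eqns"
  shows "\<exists>\<kappa>. pinned (\<lambda>e. axis_dir (\<kappa> e)) eqns"
proof -
  have "\<exists>d' \<kappa>. pinned d' eqns \<and> (\<forall>e\<in>F. d' e = axis_dir (\<kappa> e))" if "F \<subseteq> edges G" for F
  proof -
    have "finite F" by (rule finite_subset[OF that]) simp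
    then show ?thesis using that
    proof (induction F rule: finite_induct)
      case empty
      then show ?case using assms by blast
    next
      case (insert e F)
      then obtain d' \<kappa> where d': "pinned d' eqns" "\<forall>e\<in>F. d' e = axis_dir (\<kappa> e)" by blast
      obtain c where "pinned (d'(e := axis_dir c)) eqns"
        using pinned_axis_dir_edge[OF d'(1), of e] insert.prems by blast
      moreover have "\<forall>f\<in>insert e F. (d'(e := axis_dir c)) f = axis_dir ((\<kappa>(e := c)) f)"
        using d'(2) by simp
      ultimately show ?case by blast
    qed
  qed
  then obtain d' \<kappa> where d': "pinned d' eqns" "\<forall>e\<in>edges G. d' e = axis_dir (\<kappa> e)" by blast
  have "lhs G d' r u = lhs G (\<lambda>e. axis_dir (\<kappa> e)) r u" if "r \<in> eqns" for r u
    using d'(2) that by (cases r) auto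
  then have "pinned (\<lambda>e. axis_dir (\<kappa> e)) eqns" using d'(1) unfolding pinned_def by simp
  then show ?thesis by blast
qed

lemma equal_along_component:
  assumes "(i, j) \<in> (adjacency G F)\<^sup>*" "F \<subseteq> edges G" "\<And>e. e \<in> F \<Longrightarrow> f (tail G e) = f (head G e)"
  shows "f i = f j"
  using assms(1)
proof induction
  case (step j k)
  then obtain e where e: "e \<in> F" "ends G e = {j, k}" by (auto simp: adjacency_def)
  then have "{j, k} = {tail G e, head G e}" using tail_head(4)[of e] assms(2) by auto
  then show ?case using step.IH assms(3)[OF e(1)] by (auto simp: doubleton_eq_iff)
qed simp

lemma components_of_edges_iff:
  "T \<in> components_of_edges G F \<longleftrightarrow>
     (\<exists>i\<in>verts G. T = {j \<in> verts G. (i, j) \<in> (adjacency G F)\<^sup>*})"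
  by (auto simp: components_of_edges_def quotient_def Image_def)

lemma adjacency_step:
  assumes "e \<in> F" "e \<in> edges G"
  shows "(tail G e, head G e) \<in> adjacency G F" "(head G e, tail G e) \<in> adjacency G F"
  using tail_head(4)[OF assms(2)] assms(1) by (auto simp: adjacency_def insert_commute)

lemma axis_kernelD:
  assumes "\<forall>r\<in>R. lhs G (\<lambda>e. axis_dir (\<kappa> e)) r u = 0" "Inl e \<in> R"
  shows "u (tail G e, \<kappa> e) = u (head G e, \<kappa> e)"
  using assms lhs_axis_dir[of "\<lambda>e. axis_dir (\<kappa> e)" e "\<kappa> e" u] by blast

text \<open>Without \<open>r\<close> there are fewer equations than unknowns, so some nonzero vector
  satisfies the others; since the full system has a trivial kernel, this vector violates
  \<open>r\<close>.\<close>

lemma no_redundant_equation: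
  assumes "pinned d eqns" "card eqns = 2 * card (verts G)" "r \<in> eqns"
  shows "\<exists>u. (\<forall>r'\<in>eqns - {r}. lhs G d r' u = 0) \<and> lhs G d r u \<noteq> 0"
proof (rule ccontr)
  assume *: "\<not> ?thesis"
  have "pinned d (eqns - {r})"
    unfolding pinned_def
  proof (intro allI impI)
    fix u assume "\<forall>r'\<in>eqns - {r}. lhs G d r' u = 0"
    with * have "\<forall>r'\<in>eqns. lhs G d r' u = 0" by blast
    with assms(1) show "\<forall>j\<in>unknowns. u j = 0" unfolding pinned_def by blast
  qed
  from pinned_card[OF Diff_subset this] have "card eqns \<le> card (eqns - {r})" using assms(2) by simp
  moreover have "card (eqns - {r}) < card eqns"
    using assms(3) by (intro psubset_card_mono) auto
  ultimately show False by simp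
qed

text \<open>On a cycle of color \<open>col\<close>, equality of that coordinate along all edges but
  one implies it along the last, whose equation would be redundant.\<close>

lemma axis_pinned_imp_forest:
  assumes pin: "pinned (\<lambda>e. axis_dir (\<kappa> e)) eqns" and card: "card eqns = 2 * card (verts G)"
  shows "forest G {e \<in> edges G. \<kappa> e = col}"
  unfolding forest_def
proof (intro conjI notI)
  assume "\<exists>vs es. cycle_in G {e \<in> edges G. \<kappa> e = col} vs es"
  then obtain vs es where cyc: "length vs = length es" "length es \<ge> 2" "distinct es"
    "set es \<subseteq> {e \<in> edges G. \<kappa> e = col}"
    "\<And>k. k < length es \<Longrightarrow> ends G (es ! k) = {vs ! k, vs ! (Suc k mod length vs)}"
    unfolding cycle_in_def by blast
  have es: "es ! k \<in> edges G" "\<kappa> (es ! k) = col" if "k < length es" for k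
    using cyc(4) that nth_mem by blast+
  have zero: "0 < length es" using cyc(2) by linarith
  have "Inl (es ! 0) \<in> eqns" using es(1)[OF zero] by blast
  from no_redundant_equation[OF pin card this] obtain u where
    u: "\<forall>r\<in>eqns - {Inl (es ! 0)}. lhs G (\<lambda>e. axis_dir (\<kappa> e)) r u = 0"
    and u0: "lhs G (\<lambda>e. axis_dir (\<kappa> e)) (Inl (es ! 0)) u \<noteq> 0" by blast
  have step: "u (vs ! k, col) = u (vs ! (Suc k mod length vs), col)" if "0 < k" "k < length es" for k
  proof -
    have "es ! k \<noteq> es ! 0" using nth_eq_iff_index_eq[OF cyc(3)] that zero by auto
    then have "u (tail G (es ! k), col) = u (head G (es ! k), col)"
      using axis_kernelD[OF u, of "es ! k"] es[OF that(2)] by auto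
    moreover have "{vs ! k, vs ! (Suc k mod length vs)} = {tail G (es ! k), head G (es ! k)}"
      using cyc(5)[OF that(2)] tail_head(4)[OF es(1)[OF that(2)]] by simp
    ultimately show ?thesis by (auto simp: doubleton_eq_iff)
  qed
  have path: "Suc k < length es \<Longrightarrow> u (vs ! Suc k, col) = u (vs ! 1, col)" for k
  proof (induction k)
    case (Suc k)
    then show ?case using step[of "Suc k"] cyc(1) by simp
  qed simp
  \<comment> \<open>Edge \<open>Suc m\<close> is the last one and closes the cycle at
    \<open>vs ! 0\<close>; two parallel edges are the case \<open>m = 0\<close>.\<close>
  define m where "m = length es - 2"
  have m: "length es = Suc (Suc m)" using cyc(2) by (simp add: m_def)
  have "u (vs ! 1, col) = u (vs ! 0, col)"
    using path[of m] step[of "Suc m"] cyc(1) m by simp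
  moreover have "{vs ! 0, vs ! 1} = {tail G (es ! 0), head G (es ! 0)}"
    using cyc(5)[OF zero] tail_head(4)[OF es(1)[OF zero]] cyc(1) m by simp
  ultimately have "u (tail G (es ! 0), col) = u (head G (es ! 0), col)" by (auto simp: doubleton_eq_iff)
  with u0 es(2)[OF zero] show False
    using lhs_axis_dir[of "\<lambda>e. axis_dir (\<kappa> e)" "es ! 0" "\<kappa> (es ! 0)" u] by simp
qed auto

text \<open>If \<open>T\<close> had no loop of color \<open>col\<close>, its indicator in that
  coordinate would be a kernel vector. If it had two, the second would be redundant, since the
  coordinate is constant on \<open>T\<close>.\<close>

lemma axis_pinned_imp_unique_loop:
  assumes pin: "pinned (\<lambda>e. axis_dir (\<kappa> e)) eqns" and card: "card eqns = 2 * card (verts G)"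
    and T: "T \<in> components_of_edges G {e \<in> edges G. \<kappa> e = col}"
  shows "\<exists>!l. l \<in> loops G \<and> loop_color G l = col \<and> base G l \<in> T"
proof -
  let ?F = "{e \<in> edges G. \<kappa> e = col}"
  obtain i where i: "i \<in> verts G" "T = {j \<in> verts G. (i, j) \<in> (adjacency G ?F)\<^sup>*}"
    using T by (auto simp: components_of_edges_iff)
  have "\<exists>l. l \<in> loops G \<and> loop_color G l = col \<and> base G l \<in> T"
  proof (rule ccontr)
    assume no: "\<not> ?thesis"
    define u where "u = (\<lambda>(v, c). of_bool (v \<in> T \<and> c = col) :: real)"
    have "lhs G (\<lambda>e. axis_dir (\<kappa> e)) r u = 0" if "r \<in> eqns" for r
    proof (cases r)
      case (Inl e)
      then have e: "e \<in> edges G" using that by auto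
      have "u (tail G e, \<kappa> e) = u (head G e, \<kappa> e)"
      proof (cases "\<kappa> e = col")
        case True
        then have "e \<in> ?F" using e by simp
        from adjacency_step[OF this e] have "tail G e \<in> T \<longleftrightarrow> head G e \<in> T"
          unfolding i(2) using tail_head[OF e] by (auto intro: rtrancl_into_rtrancl)
        then show ?thesis by (simp add: u_def)
      qed (simp add: u_def)
      then show ?thesis
        using lhs_axis_dir[of "\<lambda>e. axis_dir (\<kappa> e)" e "\<kappa> e" u] Inl by blast
    next
      case (Inr l)
      then show ?thesis using no that by (auto simp: u_def)
    qed
    moreover have "(i, col) \<in> unknowns" "u (i, col) \<noteq> 0" using i by (auto simp: u_def)
    ultimately show False using pin unfolding pinned_def by blast
  qed
  moreover have "l1 = l2" if l1: "l1 \<in> loops G" "loop_color G l1 = col" "base G l1 \<in> T"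
    and l2: "l2 \<in> loops G" "loop_color G l2 = col" "base G l2 \<in> T" for l1 l2
  proof (rule ccontr)
    assume "l1 \<noteq> l2"
    have "Inr l2 \<in> eqns" using l2 by blast
    from no_redundant_equation[OF pin card this] obtain u where
      u: "\<forall>r\<in>eqns - {Inr l2}. lhs G (\<lambda>e. axis_dir (\<kappa> e)) r u = 0"
      and u2: "lhs G (\<lambda>e. axis_dir (\<kappa> e)) (Inr l2) u \<noteq> 0" by blast
    have edge: "u (tail G e, col) = u (head G e, col)" if "e \<in> ?F" for e
      using axis_kernelD[OF u, of e] that by auto
    have "u (i, col) = u (j, col)" if "j \<in> T" for j
      using equal_along_component[of i j ?F "\<lambda>v. u (v, col)"] that edge unfolding i(2) by blast
    then have "u (base G l1, col) = u (base G l2, col)" using l1 l2 by metis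
    moreover have "lhs G (\<lambda>e. axis_dir (\<kappa> e)) (Inr l1) u = 0" using u l1 \<open>l1 \<noteq> l2\<close> by blast
    ultimately show False using u2 l1 l2 by simp
  qed
  ultimately show ?thesis by blast
qed

text \<open>If a sparsity bound fails, the dependence polynomial vanishes at every network with a
  faithful realization. If both bounds hold, one network with a unique faithful realization would
  already give a coloring.\<close>

lemma generic_unique_faithful_imp_color_looped_Laman:
  assumes "\<not> color_looped_Laman G"
  shows "\<exists>g x. param_polynomial G g \<and> g x \<noteq> 0 \<and>
    (\<forall>d s. (\<exists>!p. realization G d s p \<and> faithful G p) \<longrightarrow> g (d, s) = 0)"
proof (cases "\<exists>V E L. subgraph V E L G \<and> 2 * card V < card E + card L")
  case True
  then obtain V E L where "subgraph V E L G" "2 * card V < card E + card L" by blast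
  from too_many_equations_nongeneric[OF this] show ?thesis by blast
next
  case sparse: False
  show ?thesis
  proof (cases "\<exists>V E L. subgraph V E L G \<and> 2 \<le> card V \<and> 2 * int (card V) - 3 < int (card E)")
    case True
    then obtain V E L where "subgraph V E L G" "2 \<le> card V" "2 * int (card V) - 3 < int (card E)" by blast
    from too_many_edges_nongeneric[OF this] show ?thesis by blast
  next
    case sparse2: False
    have "color_looped_Laman G" if "\<exists>!p. realization G d s p \<and> faithful G p" for d s
    proof -
      have pin: "pinned d eqns" using that by (rule unique_faithful_imp_pinned)
      have "subgraph (verts G) (edges G) (loops G) G"
        using tail_head by (auto simp: subgraph_def base_in_verts)
      \<comment> \<open>Sparsity of the whole graph bounds the number of equations from above and
        the trivial kernel bounds it from below, so the system is square.\<close>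
      with sparse have "\<not> 2 * card (verts G) < card eqns" unfolding card_eqns by blast
      with pinned_card[OF order_refl pin] have card: "card eqns = 2 * card (verts G)" by simp
      have "looped_Laman G"
        unfolding looped_Laman_def
      proof (intro conjI allI impI)
        show "card (edges G) + card (loops G) = 2 * card (verts G)" using card by (simp add: card_eqns)
      next
        fix V E L assume "subgraph V E L G"
        with sparse have "\<not> 2 * card V < card E + card L" by blast
        then show "card E + card L \<le> 2 * card V" by simp
      next
        fix V E L assume "subgraph V E L G" "2 \<le> card V"
        with sparse2 have "\<not> 2 * int (card V) - 3 < int (card E)" by blast
        then show "int (card E) \<le> 2 * int (card V) - 3" by simp
      qed
      moreover obtain \<kappa> where "pinned (\<lambda>e. axis_dir (\<kappa> e)) eqns"
        using pinned_imp_axis_pinned[OF pin] by blast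
      ultimately show ?thesis
        unfolding color_looped_Laman_def
        using axis_pinned_imp_forest[OF _ card] axis_pinned_imp_unique_loop[OF _ card] by blast
    qed
    with assms have "\<not> (\<exists>!p. realization G d s p \<and> faithful G p)" for d s by blast
    \<comment> \<open>No network has a unique faithful realization, so a nonzero constant
      suffices.\<close>
    then show ?thesis by (intro exI[of _ "\<lambda>_. 1"]) (simp add: param_polynomial.const)
  qed
qed

end

subsection \<open>Faithfulness of the generic realization\<close>

context looped
begin

text \<open>Independence of the slider positions is recorded because the sliders are later moved to
  fit an arbitrary solution of the edge equations.\<close>

definition direction_polynomial :: "(('e \<Rightarrow> real^2) \<times> ('l \<Rightarrow> real) \<Rightarrow> real) \<Rightarrow> bool" where
  "direction_polynomial f \<longleftrightarrow> param_polynomial G f \<and> (\<forall>d s s'. f (d, s) = f (d, s'))"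

lemma direction_polynomial_mult:
  assumes "direction_polynomial f" "direction_polynomial h"
  shows "direction_polynomial (\<lambda>x. f x * h x)"
  unfolding direction_polynomial_def
proof (intro conjI allI)
  show "param_polynomial G (\<lambda>x. f x * h x)"
    using assms by (intro param_polynomial.mult) (simp_all add: direction_polynomial_def)
  fix d s s'
  have "f (d, s) = f (d, s')" "h (d, s) = h (d, s')"
    using assms unfolding direction_polynomial_def by blast+
  then show "f (d, s) * h (d, s) = f (d, s') * h (d, s')" by simp
qed

lemma direction_polynomial_diff:
  assumes "direction_polynomial f" "direction_polynomial h"
  shows "direction_polynomial (\<lambda>x. f x - h x)"
  unfolding direction_polynomial_def
proof (intro conjI allI)
  show "param_polynomial G (\<lambda>x. f x - h x)"
    using assms by (intro param_polynomial_diff) (simp_all add: direction_polynomial_def)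
  fix d s s'
  have "f (d, s) = f (d, s')" "h (d, s) = h (d, s')"
    using assms unfolding direction_polynomial_def by blast+
  then show "f (d, s) - h (d, s) = f (d, s') - h (d, s')" by simp
qed

lemma direction_polynomial_const: "direction_polynomial (\<lambda>x. c)"
  unfolding direction_polynomial_def by (simp add: param_polynomial.const)

lemma direction_polynomial_coef:
  assumes "r \<in> eqns"
  shows "direction_polynomial (\<lambda>x. coef G (fst x) r j)"
proof (cases r)
  case (Inl e)
  have dir: "direction_polynomial (\<lambda>x. fst x e $ k)" for k
    using param_polynomial.dir_coord[of e G k] assms Inl
    by (auto simp: direction_polynomial_def case_prod_unfold)
  have "direction_polynomial (\<lambda>x. - fst x e $ 2)"
    using direction_polynomial_diff[OF direction_polynomial_const[of 0] dir[of 2]] by simp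
  then have "direction_polynomial (\<lambda>x. case snd j of Red \<Rightarrow> - fst x e $ 2 | Blue \<Rightarrow> fst x e $ 1)"
    using dir[of 1] by (cases "snd j") simp_all
  then show ?thesis
    unfolding Inl coef.simps by (intro direction_polynomial_mult direction_polynomial_const)
qed (simp add: direction_polynomial_const)

text \<open>In a kernel vector, coordinate \<open>c\<close> is constant on each tree of color
  \<open>c\<close>, and the loop of the tree sets it to 0.\<close>

lemma color_looped_Laman_imp_axis_pinned:
  assumes "color_looped_Laman G"
  shows "\<exists>\<kappa>. pinned (\<lambda>e. axis_dir (\<kappa> e)) eqns"
proof -
  obtain \<kappa> where \<kappa>: "\<forall>col. forest G {e \<in> edges G. \<kappa> e = col} \<and>
      (\<forall>T\<in>components_of_edges G {e \<in> edges G. \<kappa> e = col}.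
         \<exists>!l. l \<in> loops G \<and> loop_color G l = col \<and> base G l \<in> T)"
    using assms unfolding color_looped_Laman_def by (elim conjE exE)
  have "u (v, c) = 0" if u: "\<forall>r\<in>eqns. lhs G (\<lambda>e. axis_dir (\<kappa> e)) r u = 0" and v: "v \<in> verts G" for u v c
  proof -
    let ?F = "{e \<in> edges G. \<kappa> e = c}"
    have "{w \<in> verts G. (v, w) \<in> (adjacency G ?F)\<^sup>*} \<in> components_of_edges G ?F"
      using v by (auto simp: components_of_edges_iff)
    from \<kappa>[rule_format, THEN conjunct2, rule_format, OF this] obtain l where l: "l \<in> loops G" "loop_color G l = c"
      "(v, base G l) \<in> (adjacency G ?F)\<^sup>*" by blast
    have "u (tail G e, c) = u (head G e, c)" if "e \<in> ?F" for e
      using axis_kernelD[OF u, of e] that by auto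
    then have "u (v, c) = u (base G l, c)"
      using equal_along_component[OF l(3), of "\<lambda>w. u (w, c)"] by blast
    also have "\<dots> = lhs G (\<lambda>e. axis_dir (\<kappa> e)) (Inr l) u" using l by simp
    also have "\<dots> = 0" using u l by blast
    finally show ?thesis .
  qed
  then have "pinned (\<lambda>e. axis_dir (\<kappa> e)) eqns" unfolding pinned_def by auto
  then show ?thesis by blast
qed

lemma pinned_solvable:
  assumes "pinned d eqns" "card eqns = 2 * card (verts G)"
  shows "\<exists>u. \<forall>r\<in>eqns. lhs G d r u = b r"
proof -
  have "\<exists>u. \<forall>r\<in>eqns. (\<Sum>j\<in>unknowns. coef G d r j * u j) = b r"
  proof (rule square_system_solvable)
    show "card eqns = card unknowns" using assms(2) by (simp only: card_unknowns)
    fix u assume "\<forall>r\<in>eqns. (\<Sum>j\<in>unknowns. coef G d r j * u j) = 0"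
    with assms(1) show "\<forall>j\<in>unknowns. u j = 0" unfolding pinned_def system_iff by blast
  qed simp_all
  then show ?thesis unfolding system_iff .
qed

text \<open>The solution is the quotient \<open>q j / g\<close>. Here \<open>g\<close> comes from
  the coefficients alone, so it depends on the directions only.\<close>

lemma generic_solution:
  assumes "pinned d0 eqns" "card eqns = 2 * card (verts G)"
  shows "\<exists>g q x. direction_polynomial g \<and> g x \<noteq> 0 \<and> (\<forall>j\<in>unknowns. param_polynomial G (q j)) \<and>
    (\<forall>d s. g (d, s) \<noteq> 0 \<longrightarrow> pinned d eqns) \<and>
    (\<forall>d s u. (\<forall>r\<in>eqns. lhs G d r u = rhs s r) \<longrightarrow> (\<forall>j\<in>unknowns. g (d, s) * u j = q j (d, s)))"
proof -
  let ?A = "\<lambda>r j x. coef G (fst x) r j" and ?b = "\<lambda>r x. rhs (snd x) r"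
  let ?x = "(d0, \<lambda>_. 0) :: ('e \<Rightarrow> real^2) \<times> ('l \<Rightarrow> real)"
  have "\<exists>g q. direction_polynomial g \<and> g ?x \<noteq> 0 \<and> (\<forall>j\<in>unknowns. param_polynomial G (q j)) \<and>
    (\<forall>x u. (\<forall>r\<in>eqns. (\<Sum>j\<in>unknowns. ?A r j x * u j) = 0) \<longrightarrow> (\<forall>j\<in>unknowns. g x * u j = 0)) \<and>
    (\<forall>x u. (\<forall>r\<in>eqns. (\<Sum>j\<in>unknowns. ?A r j x * u j) = ?b r x) \<longrightarrow> (\<forall>j\<in>unknowns. g x * u j = q j x))"
  proof (rule generic_elimination)
    show "card eqns = card unknowns" using assms(2) by (simp only: card_unknowns)
  next
    fix r assume r: "r \<in> eqns"
    show "param_polynomial G (?b r)"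
    proof (cases r)
      case (Inl e)
      then show ?thesis by (simp add: param_polynomial.const)
    next
      case (Inr l)
      then show ?thesis using param_polynomial.slider_coord[of l G] r by (auto simp: case_prod_unfold)
    qed
    show "direction_polynomial (?A r j)" for j by (rule direction_polynomial_coef[OF r])
  next
    fix u assume "\<forall>r\<in>eqns. (\<Sum>j\<in>unknowns. ?A r j ?x * u j) = 0"
    with assms(1) show "\<forall>j\<in>unknowns. u j = 0" unfolding pinned_def fst_conv system_iff by blast
  next
    show "direction_polynomial f \<Longrightarrow> param_polynomial G f" for f by (simp add: direction_polynomial_def)
  qed (simp_all add: direction_polynomial_mult direction_polynomial_diff direction_polynomial_const
      param_polynomial.mult param_polynomial_diff)
  then obtain g q where g: "direction_polynomial g" "g ?x \<noteq> 0"
    and q: "\<forall>j\<in>unknowns. param_polynomial G (q j)"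
    and ker: "\<And>x u. \<forall>r\<in>eqns. (\<Sum>j\<in>unknowns. ?A r j x * u j) = 0 \<Longrightarrow> \<forall>j\<in>unknowns. g x * u j = 0"
    and sol: "\<And>x u. \<forall>r\<in>eqns. (\<Sum>j\<in>unknowns. ?A r j x * u j) = ?b r x \<Longrightarrow> \<forall>j\<in>unknowns. g x * u j = q j x"
    by blast
  have pin: "pinned d eqns" if "g (d, s) \<noteq> 0" for d s
    unfolding pinned_def
  proof (intro allI impI ballI)
    fix u j assume u: "\<forall>r\<in>eqns. lhs G d r u = 0" and j: "j \<in> unknowns"
    have "\<forall>r\<in>eqns. (\<Sum>j\<in>unknowns. ?A r j (d, s) * u j) = 0"
      unfolding fst_conv system_iff by (rule u)
    from bspec[OF ker[OF this] j] that show "u j = 0" by simp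
  qed
  have eq: "\<forall>j\<in>unknowns. g (d, s) * u j = q j (d, s)"
    if u: "\<forall>r\<in>eqns. lhs G d r u = rhs s r" for d s u
  proof -
    have "\<forall>r\<in>eqns. (\<Sum>j\<in>unknowns. ?A r j (d, s) * u j) = ?b r (d, s)"
      unfolding fst_conv snd_conv system_iff by (rule u)
    from sol[OF this] show ?thesis .
  qed
  show ?thesis using g q pin eq by blast
qed

text \<open>If every solution of the equations of the edges in \<open>C\<close> has the ends of each of these
  edges coincide, then on each component \<open>V\<close> of \<open>C\<close> the equations leave only the translations,
  so there are at least \<open>2|V| - 2\<close> of them.\<close>

lemma looped_Laman_imp_no_collapse:
  assumes "looped_Laman G" "C \<subseteq> edges G"
    and collapse: "\<And>u e c. \<lbrakk>\<And>f. f \<in> C \<Longrightarrow> lhs G d (Inl f) u = 0; e \<in> C\<rbrakk> \<Longrightarrow> u (tail G e, c) = u (head G e, c)"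
  shows "C = {}"
proof (rule ccontr)
  assume "C \<noteq> {}"
  then obtain e0 where e0: "e0 \<in> C" by blast
  let ?o = "tail G e0"
  define V where "V = {v \<in> verts G. (?o, v) \<in> (adjacency G C)\<^sup>*}"
  define E where "E = {e \<in> C. tail G e \<in> V}"
  have iff: "tail G e \<in> V \<longleftrightarrow> head G e \<in> V" if "e \<in> C" for e
  proof -
    have e: "e \<in> edges G" using that assms(2) by blast
    show ?thesis
      unfolding V_def using adjacency_step[OF that e] tail_head[OF e] by (auto intro: rtrancl_into_rtrancl)
  qed
  have o: "?o \<in> V" using e0 assms(2) tail_head by (auto simp: V_def)
  have finV: "finite V" by (simp add: V_def)
  have "subgraph V E {} G"
    unfolding subgraph_def
  proof (intro conjI ballI)
    fix e assume "e \<in> E"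
    then show "ends G e \<subseteq> V" using iff[of e] tail_head(4)[of e] assms(2) by (auto simp: E_def)
  qed (use assms(2) in \<open>auto simp: E_def V_def\<close>)
  moreover have "card {?o, head G e0} \<le> card V"
    using o iff[OF e0] finV by (intro card_mono) auto
  then have "2 \<le> card V" using tail_head(3)[of e0] e0 assms(2) by auto
  ultimately have "int (card E) \<le> 2 * int (card V) - 3"
    using assms(1) unfolding looped_Laman_def by blast
  moreover have "card ((V - {?o}) \<times> (UNIV :: color set)) = 2 * (card V - 1)"
    using o finV by (simp add: card_cartesian_product)
  moreover have "card (Inl ` E :: ('e + 'l) set) = card E" by (simp add: card_image)
  \<comment> \<open>At most \<open>2|V| - 3\<close> equations face \<open>2|V| - 2\<close> unknowns
    once \<open>?o\<close> is held at the origin.\<close>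
  ultimately have "card (Inl ` E :: ('e + 'l) set) < card ((V - {?o}) \<times> (UNIV :: color set))"
    using \<open>2 \<le> card V\<close> by linarith
  moreover have "Inl ` E \<subseteq> eqns" using assms(2) by (auto simp: E_def)
  moreover have "(V - {?o}) \<times> UNIV \<subseteq> unknowns" by (auto simp: V_def)
  ultimately obtain u where u: "\<exists>j\<in>(V - {?o}) \<times> UNIV. u j \<noteq> 0"
    "\<forall>j. j \<notin> (V - {?o}) \<times> UNIV \<longrightarrow> u j = 0" "\<forall>r\<in>Inl ` E. lhs G d r u = 0"
    using underdetermined_eqns[of "Inl ` E" "(V - {?o}) \<times> UNIV" d] by blast
  \<comment> \<open>The edges of \<open>C\<close> outside \<open>E\<close> have both ends outside
    \<open>V\<close>, where \<open>u\<close> is 0.\<close>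
  have "lhs G d (Inl f) u = 0" if "f \<in> C" for f
  proof (cases "f \<in> E")
    case False
    then have "tail G f \<notin> V" "head G f \<notin> V" using iff[OF that] that by (auto simp: E_def)
    then show ?thesis using u(2) by simp
  qed (use u(3) in blast)
  from collapse[OF this] have const: "u (tail G e, c) = u (head G e, c)" if "e \<in> C" for e c
    using that by blast
  obtain v c where v: "v \<in> V" "u (v, c) \<noteq> 0" using u(1) by auto
  have "u (?o, c) = u (v, c)"
    using equal_along_component[of ?o v C "\<lambda>w. u (w, c)"] v(1) const assms(2) by (simp add: V_def)
  with u(2) v(2) show False by simp
qed

lemma color_looped_Laman_imp_generic_unique_faithful:
  assumes CLL: "color_looped_Laman G"
  shows "\<exists>g x. param_polynomial G g \<and> g x \<noteq> 0 \<and>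
    (\<forall>d s. g (d, s) \<noteq> 0 \<longrightarrow> (\<exists>!p. realization G d s p \<and> faithful G p))"
proof -
  have LL: "looped_Laman G" using CLL by (simp add: color_looped_Laman_def)
  then have card: "card eqns = 2 * card (verts G)" by (simp add: looped_Laman_def card_eqns)
  obtain \<kappa> where \<kappa>: "pinned (\<lambda>e. axis_dir (\<kappa> e)) eqns"
    using color_looped_Laman_imp_axis_pinned[OF CLL] by blast
  obtain g q x0 where g: "direction_polynomial g" "g x0 \<noteq> 0"
    and q: "\<forall>j\<in>unknowns. param_polynomial G (q j)"
    and pin: "\<forall>d s. g (d, s) \<noteq> 0 \<longrightarrow> pinned d eqns"
    and sol: "\<forall>d s u. (\<forall>r\<in>eqns. lhs G d r u = rhs s r) \<longrightarrow> (\<forall>j\<in>unknowns. g (d, s) * u j = q j (d, s))"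
    using generic_solution[OF \<kappa> card] by (elim exE conjE)
  note pin = pin[rule_format] and sol = sol[THEN spec, THEN spec, THEN spec, THEN mp]
  have gpoly: "param_polynomial G g" and gdir: "\<And>d s s'. g (d, s) = g (d, s')"
    using g(1) unfolding direction_polynomial_def by blast+
  \<comment> \<open>A sum of squares is a single real polynomial that vanishes exactly when both
    coordinates agree; on solutions it is \<open>g^2\<close> times the squared distance of the
    ends.\<close>
  define h where "h e = (\<lambda>x. (q (tail G e, Red) x - q (head G e, Red) x)^2
      + (q (tail G e, Blue) x - q (head G e, Blue) x)^2)" for e
  have hpoly: "param_polynomial G (h e)" if "e \<in> edges G" for e
  proof -
    have "param_polynomial G (q (tail G e, c))" "param_polynomial G (q (head G e, c))" for c
      using q tail_head[OF that] by simp_all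
    then show ?thesis
      unfolding h_def by (intro param_polynomial.add param_polynomial_power param_polynomial_diff)
  qed
  have h_iff: "h e x = 0 \<longleftrightarrow> (\<forall>c. q (tail G e, c) x = q (head G e, c) x)" for e x
    by (simp add: h_def all_color sum_power2_eq_zero_iff)
  have coincide: "h e (d, s) = 0 \<longleftrightarrow> (\<forall>c. u (tail G e, c) = u (head G e, c))"
    if "e \<in> edges G" "g (d, s) \<noteq> 0" "\<forall>r\<in>eqns. lhs G d r u = rhs s r" for e d s u
  proof -
    have "q (tail G e, c) (d, s) = g (d, s) * u (tail G e, c)"
      "q (head G e, c) (d, s) = g (d, s) * u (head G e, c)" for c
      using sol[OF that(3), THEN bspec, of "(tail G e, c)"] sol[OF that(3), THEN bspec, of "(head G e, c)"]
        tail_head[OF that(1)] by simp_all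
    then show ?thesis unfolding h_iff using that(2) by simp
  qed
  define C where "C = {e \<in> edges G. \<forall>x. g x \<noteq> 0 \<longrightarrow> h e x = 0}"
  \<comment> \<open>\<open>H x \<noteq> 0\<close> is the genericity condition: the system is
    nonsingular and no edge outside \<open>C\<close> collapses.\<close>
  define H where "H = (\<lambda>x. g x * (\<Prod>e\<in>edges G - C. h e x))"
  have prodpoly: "param_polynomial G (\<lambda>x. \<Prod>e\<in>edges G - C. h e x)"
    by (rule param_polynomial_prod) (simp_all add: hpoly)
  have Hpoly: "param_polynomial G H"
    unfolding H_def by (rule param_polynomial.mult[OF gpoly prodpoly])
  have "\<exists>x. (\<Prod>e\<in>edges G - C. h e x) \<noteq> 0"
    by (rule param_polynomial_prod_nonzero[of _ G]) (use hpoly in \<open>auto simp: C_def\<close>)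
  then obtain y where "(\<Prod>e\<in>edges G - C. h e y) \<noteq> 0" by blast
  from param_polynomial_mult_nonzero[OF gpoly g(2) prodpoly this]
  obtain x1 where x1: "H x1 \<noteq> 0" unfolding H_def by blast
  have Hg: "g x \<noteq> 0" if "H x \<noteq> 0" for x using that by (simp add: H_def)
  have Hh: "h e x \<noteq> 0" if "H x \<noteq> 0" "e \<in> edges G - C" for e x using that by (auto simp: H_def)
  have collapsed: "u (tail G e, c) = u (head G e, c)"
    if "H (d, s) \<noteq> 0" "e \<in> C" "\<And>f. f \<in> edges G \<Longrightarrow> lhs G d (Inl f) u = 0" for d s u e c
  proof -
    \<comment> \<open>Every solution of the edge equations solves the whole system for the slider
      positions read off from it, and \<open>g\<close> keeps its value under this change of
      sliders.\<close>
    let ?s = "\<lambda>l. u (base G l, loop_color G l)"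
    have gs: "g (d, ?s) \<noteq> 0" using Hg[OF that(1)] unfolding gdir[of d s ?s] .
    then have "h e (d, ?s) = 0" using that(2) by (simp add: C_def)
    moreover have "\<forall>r\<in>eqns. lhs G d r u = rhs ?s r" using that(3) by auto
    ultimately show ?thesis using coincide[OF _ gs, of e u] that(2) by (auto simp: C_def)
  qed
  have "C = {}"
  proof (rule looped_Laman_imp_no_collapse[OF LL])
    text \<open>A generic change of the direction of an edge \<open>f\<close> outside \<open>C\<close> leaves the edges of \<open>C\<close>
      collapsed, and the two equations for \<open>f\<close> are independent because \<open>f\<close> is not collapsed;
      hence the equation for \<open>f\<close> is not needed for the collapse.\<close>
    have drop: "\<forall>d u. (\<exists>s. H (d, s) \<noteq> 0) \<longrightarrow> (\<forall>f\<in>edges G - F. lhs G d (Inl f) u = 0) \<longrightarrow>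
        (\<forall>e\<in>C. \<forall>c. u (tail G e, c) = u (head G e, c))" if "F \<subseteq> edges G - C" for F
    proof -
      have "finite F" by (rule finite_subset[OF that]) simp
      then show ?thesis using that
      proof (induction F rule: finite_induct)
        case empty
        then show ?case using collapsed by auto
      next
        case (insert f F)
        show ?case
        proof (intro allI impI ballI)
          fix d u e c
          assume "\<exists>s. H (d, s) \<noteq> 0" and u: "\<forall>f'\<in>edges G - insert f F. lhs G d (Inl f') u = 0"
            and e: "e \<in> C"
          then obtain s where s: "H (d, s) \<noteq> 0" by blast
          have f: "f \<in> edges G - C" using insert.prems by blast
          obtain p where p: "\<forall>r\<in>eqns. lhs G d r p = rhs s r"
            using pinned_solvable[OF pin[OF Hg[OF s]] card, of "rhs s"] by blast
          define \<delta> where "\<delta> c = p (tail G f, c) - p (head G f, c)" for c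
          have "\<delta> Red \<noteq> 0 \<or> \<delta> Blue \<noteq> 0"
            using coincide[OF _ Hg[OF s] p, of f] Hh[OF s f] f by (auto simp: \<delta>_def all_color)
          then have \<delta>: "(\<delta> Blue)^2 + (\<delta> Red)^2 \<noteq> 0" by (auto simp: sum_power2_eq_zero_iff)
          \<comment> \<open>The gradient of the equation of \<open>f\<close> at \<open>p\<close>
            with respect to the direction: moving the direction by \<open>t *\<^sub>R w\<close>
            changes the equation at \<open>p\<close> by \<open>t\<close> times the squared length of
            \<open>f\<close>.\<close>
          define w where "w = (vector [\<delta> Blue, - \<delta> Red] :: real^2)"
          have "\<exists>P. \<forall>t. H (\<lambda>e. d e + t *\<^sub>R (if e = f then w else 0), \<lambda>l. s l + t * 0) = poly P t"
            using param_polynomial_on_line[OF Hpoly, of d "\<lambda>e. if e = f then w else 0" s "\<lambda>_. 0"] .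
          moreover have "(\<lambda>e. d e + t *\<^sub>R (if e = f then w else 0)) = d(f := d f + t *\<^sub>R w)" for t
            by (simp add: fun_eq_iff)
          ultimately obtain P where P: "\<And>t. H (d(f := d f + t *\<^sub>R w), s) = poly P t"
            by (simp only: mult_zero_right add_0_right) blast
          have "poly P 0 \<noteq> 0" using s P[of 0] by simp
          then have "P \<noteq> 0" by auto
          then obtain t where t: "t \<noteq> 0" "poly P t \<noteq> 0" using nonzero_poly_nonroot[of P 0] by blast
          let ?d = "d(f := d f + t *\<^sub>R w)"
          have other: "lhs G ?d (Inl f') v = lhs G d (Inl f') v" if "f' \<noteq> f" for f' v
            using that by (intro lhs_upd_other) simp
          have pe: "lhs G d (Inl f') p = 0" if "f' \<in> edges G" for f'
            using bspec[OF p InlI[OF that]] by simp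
          have "lhs G ?d (Inl f) p = lhs G d (Inl f) p + t * ((\<delta> Blue)^2 + (\<delta> Red)^2)"
            by (simp add: w_def \<delta>_def algebra_simps power2_eq_square)
          then have pf: "lhs G ?d (Inl f) p \<noteq> 0" using pe f t(1) \<delta> by simp
          \<comment> \<open>Subtracting \<open>a * p\<close> from \<open>u\<close> repairs the
            equation of \<open>f\<close> in the new direction and keeps the others, which
            \<open>p\<close> satisfies. Since \<open>p\<close> is collapsed on \<open>C\<close>, the
            conclusion passes from \<open>v\<close> back to \<open>u\<close>.\<close>
          define a where "a = lhs G ?d (Inl f) u / lhs G ?d (Inl f) p"
          define v where "v = (\<lambda>j. 1 * u j - a * p j)"
          have "lhs G ?d (Inl f') v = 0" if f': "f' \<in> edges G - F" for f'
          proof (cases "f' = f")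
            case True
            have "lhs G ?d (Inl f) v = lhs G ?d (Inl f) u - a * lhs G ?d (Inl f) p"
              unfolding v_def lhs_diff_scale by (simp only: mult_1)
            also have "\<dots> = 0" using pf by (simp add: a_def del: lhs.simps)
            finally show ?thesis by (simp only: True)
          next
            case False
            then have "lhs G d (Inl f') u = 0" "lhs G d (Inl f') p = 0" using u f' pe by blast+
            then show ?thesis unfolding other[OF False] v_def lhs_diff_scale by (simp only: mult_zero_right diff_self)
          qed
          moreover have "\<exists>s. H (?d, s) \<noteq> 0" using P[of t] t(2) by metis
          ultimately have "v (tail G e, c) = v (head G e, c)"
            using insert.IH insert.prems e by blast
          moreover have "p (tail G e, c) = p (head G e, c)" using collapsed[OF s e pe] .
          ultimately show "u (tail G e, c) = u (head G e, c)" by (simp add: v_def)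
        qed
      qed
    qed
    show "C \<subseteq> edges G" by (auto simp: C_def)
    fix u e c assume "\<And>f. f \<in> C \<Longrightarrow> lhs G (fst x1) (Inl f) u = 0" "e \<in> C"
    moreover have "\<exists>s. H (fst x1, s) \<noteq> 0" using x1 by (intro exI[of _ "snd x1"]) simp
    ultimately show "u (tail G e, c) = u (head G e, c)"
      using drop[OF order_refl, THEN spec[of _ "fst x1"], THEN spec[of _ u]] by blast
  qed
  have unique: "\<exists>!p. realization G d s p \<and> faithful G p" if nz: "H (d, s) \<noteq> 0" for d s
  proof -
    obtain u where u: "\<forall>r\<in>eqns. lhs G d r u = rhs s r"
      using pinned_solvable[OF pin[OF Hg[OF nz]] card, of "rhs s"] by blast
    have real: "realization G d s (place u)" using u by (simp only: realization_place)
    have "faithful G (place u)"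
      unfolding faithful_iff
    proof
      fix e assume e: "e \<in> edges G"
      then have "\<exists>c. u (tail G e, c) \<noteq> u (head G e, c)"
        using coincide[OF e Hg[OF nz] u] Hh[OF nz] \<open>C = {}\<close> by blast
      then show "place u (tail G e) \<noteq> place u (head G e)"
        unfolding vec2_eq_iff_coords[of "place u" _ "place u"] using tail_head[OF e] by (simp add: coords_place)
    qed
    moreover have "p = place u" if p: "realization G d s p" for p
    proof (rule PiE_ext)
      show "p \<in> verts G \<rightarrow>\<^sub>E UNIV" "place u \<in> verts G \<rightarrow>\<^sub>E UNIV"
        using p real by (simp_all add: realization_iff_eqns)
      fix v assume v: "v \<in> verts G"
      have "coords p (v, c) = u (v, c)" for c
      proof -
        have "\<forall>r\<in>eqns. lhs G d r (coords p) = rhs s r"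
          using realization_eqn[OF p] by (rule ballI)
        from bspec[OF sol[OF this], of "(v, c)"] bspec[OF sol[OF u], of "(v, c)"] v Hg[OF nz]
        have "g (d, s) * coords p (v, c) = g (d, s) * u (v, c)" by simp
        with Hg[OF nz] show ?thesis by simp
      qed
      then show "p v = place u v"
        unfolding vec2_eq_iff_coords[of p v "place u" v] using v by (simp add: coords_place)
    qed
    ultimately show ?thesis using real by blast
  qed
  show ?thesis by (intro exI[of _ H] exI[of _ x1] conjI allI impI Hpoly x1 unique)
qed

end

section \<open>The generic equivalence for a fixed graph\<close>

theorem theorem5:
  fixes G :: "('v, 'e, 'l) lgraph"
  assumes "looped_graph G"
  shows "\<exists>S. proper_algebraic_subset G S \<and>
    (\<forall>d s. (d, s) \<in> param_space G - S \<longrightarrow>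
      ((\<exists>!p. realization G d s p \<and> faithful G p) \<longleftrightarrow> color_looped_Laman G))"
proof -
  interpret looped G using assms by unfold_locales
  \<comment> \<open>Being color-looped-Laman does not depend on \<open>d\<close> and
    \<open>s\<close>, so in each case only one implication is at stake and one polynomial is
    enough.\<close>
  obtain g x where g: "param_polynomial G g" "g x \<noteq> 0"
    and iff: "\<forall>d s. g (d, s) \<noteq> 0 \<longrightarrow>
      ((\<exists>!p. realization G d s p \<and> faithful G p) \<longleftrightarrow> color_looped_Laman G)"
  proof (cases "color_looped_Laman G")
    case True
    obtain g x where "param_polynomial G g" "g x \<noteq> 0"
      "\<forall>d s. g (d, s) \<noteq> 0 \<longrightarrow> (\<exists>!p. realization G d s p \<and> faithful G p)"
      using color_looped_Laman_imp_generic_unique_faithful[OF True] by (elim exE conjE)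
    with True show ?thesis by (intro that[of g x]) simp_all
  next
    case False
    obtain g x where "param_polynomial G g" "g x \<noteq> 0"
      "\<forall>d s. (\<exists>!p. realization G d s p \<and> faithful G p) \<longrightarrow> g (d, s) = 0"
      using generic_unique_faithful_imp_color_looped_Laman[OF False] by (elim exE conjE)
    with False show ?thesis by (intro that[of g x]) auto
  qed
  show ?thesis
  proof (intro exI conjI allI impI)
    show "proper_algebraic_subset G {x \<in> param_space G. g x = 0}"
      using g by (rule nonvanishing_complement_proper_algebraic)
    fix d s assume "(d, s) \<in> param_space G - {x \<in> param_space G. g x = 0}"
    then have "g (d, s) \<noteq> 0" by simp
    with iff show "(\<exists>!p. realization G d s p \<and> faithful G p) \<longleftrightarrow> color_looped_Laman G" by blast
  qed
qed

end
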